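(* Let $n\ge1$, $\boldsymbol\theta_0\in\mathcal T_n$, and let $\boldsymbol\gamma\in\mathcal C^n_\infty$ be a finite-energy $n$-radial multichord, i.e. $J(\boldsymbol\gamma)<\infty$, with multiradial Loewner driving function $\boldsymbol\theta$. Then $$\lim_{T\to\infty}\mathcal U(\boldsymbol\theta_T)=\inf_{\boldsymbol\alpha\in\mathcal T_n}\mathcal U(\boldsymbol\alpha)=-2\sum_{1\le i<j\le n}\log\sin\Big(\frac{\pi(j-i)}{n}\Big).$$
   Context: $\mathbb D$ is the open unit disk. $\mathcal T_n\subset(\mathbb R/2\pi\mathbb Z)^n$ is the set of elements admitting representatives $\boldsymbol\alpha$ with $\alpha^1<\cdots<\alpha^n<\alpha^1+2\pi$. The semiclassical partition function on $\mathcal T_n$ is $\mathcal U(\boldsymbol\alpha)=-2\sum_{1\le i<j\le n}\log\sin\big(\tfrac{\alpha^j-\alpha^i}2\big)$. $\mathcal C^n_\infty$ is the space of $n$-tuples $\boldsymbol\gamma=(\gamma^1,\ldots,\gamma^n)$ of curves with $\gamma^j(0)=e^{\mathrm i\theta^j_0}$, $\gamma^j(0,\infty)\subset\mathbb D$, $\lim_{t\to\infty}\gamma^j(t)=0$, each injective, pairwise disjoint on every $[0,T]$, in the common parameterization: the conformal bijections $g_t:\mathbb D\setminus\bigcup_j\gamma^j[0,t]\to\mathbb D$ with $g_t(0)=0$, $g_t'(0)>0$ solve $$\partial_tg_t(z)=g_t(z)\sum_{j=1}^n\frac{e^{\mathrm i\theta^j_t}+g_t(z)}{e^{\mathrm i\theta^j_t}-g_t(z)},\qquad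 g_0(z)=z,$$ for a continuous $\boldsymbol\theta:[0,\infty)\to\mathcal T_n$, the multiradial Loewner driving function of $\boldsymbol\gamma$. The multiradial Loewner energy is $J(\boldsymbol\gamma)=\frac12\int_0^\infty\sum_{j=1}^n\big|\tfrac{\mathrm d}{\mathrm ds}\theta^j_s-2\sum_{i\ne j}\cot\big(\tfrac{\theta^j_s-\theta^i_s}2\big)\big|^2\mathrm ds$ if $\boldsymbol\theta$ is absolutely continuous on every $[0,T]$, and $+\infty$ otherwise. *)

theory Defs
  imports "HOL-Analysis.Analysis"
begin

text \<open>
  A tuple indexed by \<open>1, \<dots>, n\<close> is a function on \<open>nat\<close> of which only the values on \<open>{1..n}\<close> are used.
  Elements of \<open>(\<real>/2\<pi>\<int>)\<^sup>n\<close> are given by real representatives.  \<open>torus_chamber n\<close> is the set of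
  ordered representatives of the elements of \<open>\<T>\<^sub>n\<close>; two of them represent the same element iff
  they differ by a common multiple of \<open>2\<pi>\<close>.  A continuous path in \<open>\<T>\<^sub>n\<close> is given by a continuous
  lift with values in \<open>torus_chamber n\<close>, which is unique up to such a (constant) multiple.
\<close>

definition torus_chamber :: "nat \<Rightarrow> (nat \<Rightarrow> real) set" where
  "torus_chamber n = {\<alpha>. (\<forall>i\<in>{1..n}. \<forall>j\<in>{1..n}. i < j \<longrightarrow> \<alpha> i < \<alpha> j) \<and> \<alpha> n < \<alpha> 1 + 2 * pi}"

definition partition_U :: "nat \<Rightarrow> (nat \<Rightarrow> real) \<Rightarrow> real" where
  "partition_U n \<alpha> = - 2 * (\<Sum>j=1..n. \<Sum>i=1..<j. ln (sin ((\<alpha> j - \<alpha> i) / 2)))"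

definition abs_continuous_on_interval :: "real \<Rightarrow> real \<Rightarrow> (real \<Rightarrow> real) \<Rightarrow> bool" where
  "abs_continuous_on_interval a b f \<longleftrightarrow>
     (\<forall>\<epsilon>>0. \<exists>\<delta>>0. \<forall>(m::nat) u v.
        (\<forall>k<m. a \<le> u k \<and> u k \<le> v k \<and> v k \<le> b) \<and>
        disjoint_family_on (\<lambda>k. {u k<..<v k}) {..<m} \<and>
        (\<Sum>k<m. v k - u k) < \<delta> \<longrightarrow>
        (\<Sum>k<m. \<bar>f (v k) - f (u k)\<bar>) < \<epsilon>)"

definition slit_disk :: "nat \<Rightarrow> (nat \<Rightarrow> real \<Rightarrow> complex) \<Rightarrow> real \<Rightarrow> complex set" where
  "slit_disk n \<gamma> t = ball 0 1 - (\<Union>j\<in>{1..n}. \<gamma> j ` {0..t})"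

definition normalized_conformal_map :: "complex set \<Rightarrow> (complex \<Rightarrow> complex) \<Rightarrow> bool" where
  "normalized_conformal_map D f \<longleftrightarrow>
     0 \<in> D \<and> f holomorphic_on D \<and> bij_betw f D (ball 0 1) \<and> f 0 = 0 \<and>
     (\<exists>r>0. deriv f 0 = complex_of_real r)"

text \<open>
  \<open>multiradial_driving n \<gamma> \<theta>\<close>: the maps \<open>g\<^sub>t\<close> uniformizing the complement of \<open>\<gamma>[0,t]\<close> solve the
  multiradial Loewner equation with the path in \<open>\<T>\<^sub>n\<close> whose lift is \<open>\<theta>\<close>.  The equation at
  time \<open>t\<close> is required at the points not yet swallowed at time \<open>t\<close>; such a point is not swallowed
  at nearby times either, and the derivative is one-sided at \<open>t = 0\<close>.
\<close>

definition multiradial_driving ::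
    "nat \<Rightarrow> (nat \<Rightarrow> real \<Rightarrow> complex) \<Rightarrow> (real \<Rightarrow> nat \<Rightarrow> real) \<Rightarrow> bool" where
  "multiradial_driving n \<gamma> \<theta> \<longleftrightarrow>
     (\<forall>t\<ge>0. \<theta> t \<in> torus_chamber n) \<and>
     (\<forall>j\<in>{1..n}. continuous_on {0..} (\<lambda>t. \<theta> t j)) \<and>
     (\<forall>j\<in>{1..n}. \<gamma> j 0 = cis (\<theta> 0 j)) \<and>
     (\<exists>g :: real \<Rightarrow> complex \<Rightarrow> complex.
        (\<forall>t\<ge>0. normalized_conformal_map (slit_disk n \<gamma> t) (g t)) \<and>
        (\<forall>z\<in>ball 0 1. g 0 z = z) \<and>
        (\<forall>t\<ge>0. \<forall>z\<in>slit_disk n \<gamma> t.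
           ((\<lambda>s. g s z) has_vector_derivative
              g t z * (\<Sum>j=1..n. (cis (\<theta> t j) + g t z) / (cis (\<theta> t j) - g t z)))
           (at t within {0..})))"

definition radial_multichords :: "nat \<Rightarrow> (nat \<Rightarrow> real) \<Rightarrow> (nat \<Rightarrow> real \<Rightarrow> complex) set" where
  "radial_multichords n \<theta>0 = {\<gamma>.
     (\<forall>j\<in>{1..n}.
        continuous_on {0..} (\<gamma> j) \<and> inj_on (\<gamma> j) {0..} \<and>
        \<gamma> j 0 = cis (\<theta>0 j) \<and> \<gamma> j ` {0<..} \<subseteq> ball 0 1 \<and> (\<gamma> j \<longlongrightarrow> 0) at_top) \<and>
     (\<forall>T\<ge>0. \<forall>i\<in>{1..n}. \<forall>j\<in>{1..n}. i \<noteq> j \<longrightarrow> \<gamma> i ` {0..T} \<inter> \<gamma> j ` {0..T} = {}) \<and>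
     (\<exists>\<theta>. multiradial_driving n \<gamma> \<theta>)}"

text \<open>
  The derivative of an absolutely continuous function exists almost everywhere, so the value of
  \<open>deriv\<close> at the remaining points does not affect the integral.
\<close>

definition driving_energy :: "nat \<Rightarrow> (real \<Rightarrow> nat \<Rightarrow> real) \<Rightarrow> ennreal" where
  "driving_energy n \<theta> =
     (if \<forall>T\<ge>0. \<forall>j\<in>{1..n}. abs_continuous_on_interval 0 T (\<lambda>t. \<theta> t j)
      then (1 / 2) * (\<integral>\<^sup>+ s\<in>{0..}. ennreal (\<Sum>j=1..n.
             \<bar>deriv (\<lambda>t. \<theta> t j) s
               - 2 * (\<Sum>i\<in>{1..n} - {j}. cot ((\<theta> s j - \<theta> s i) / 2))\<bar>\<^sup>2) \<partial>lborel)
      else \<infinity>)"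

text \<open>
  The driving function of \<open>\<gamma>\<close> is unique as a path in \<open>\<T>\<^sub>n\<close>, and the energy is the same for all
  its lifts.
\<close>

definition multiradial_energy :: "nat \<Rightarrow> (nat \<Rightarrow> real \<Rightarrow> complex) \<Rightarrow> ennreal" where
  "multiradial_energy n \<gamma> = driving_energy n (SOME \<theta>. multiradial_driving n \<gamma> \<theta>)"

end

theory Submission
  imports Defs "HOL-Complex_Analysis.Complex_Analysis"
begin

text \<open>
  A driving function solves \<open>\<theta>' = - 2 \<nabla>\<U>(\<theta>) + e\<close> with \<open>\<parallel>e\<parallel>\<^sup>2\<close> integrable, so it is a gradient
  flow with a small error and
  \<open>d/dt \<U>(\<theta>) \<le> \<parallel>e\<parallel>\<^sup>2 / 4 - \<parallel>\<nabla>\<U>(\<theta>)\<parallel>\<^sup>2\<close> almost everywhere.  Since \<open>- 2 ln (sin (x / 2))\<close> is convex,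
  \<open>\<U>\<close> is convex on the chamber; it is minimal at the equispaced configuration, where its gradient
  vanishes by symmetry, and \<open>\<U> - min \<U> \<le> 2 \<pi> \<Sum>\<^sub>j \<bar>\<partial>\<^sub>j \<U>\<bar>\<close>.  Thus \<open>G = \<U>(\<theta>) - min \<U>\<close> satisfies
  \<open>G' \<le> \<parallel>e\<parallel>\<^sup>2 / 4 - c G\<^sup>2\<close> with \<open>c > 0\<close>, which forces \<open>G \<longrightarrow> 0\<close>.

  The energy is computed from an unspecified driving function of \<open>\<gamma>\<close>.  Any two of them have the same
  driving points at positive times, because the uniformizing maps agree by the Schwarz lemma and the
  points are the poles of the Loewner vector field; and \<open>\<U>\<close> depends only on the set of points.
\<close>

section \<open>Differentiability of absolutely continuous functions\<close>

text \<open>The differential inequality holds only at almost every time, so it must be integrated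
  before it can be used. This takes two facts: an absolutely continuous function is differentiable
  almost everywhere, and an almost-everywhere upper bound on its derivative bounds its increments.
  Upper bounds on increments are all that the limit argument consumes. The constant 2 \<pi> comes
  from rotation invariance: the gradient has zero sum, so two configurations may be aligned at their
  first point, after which corresponding angles differ by at most 2 \<pi>. The last step needs no
  explicit solution of the inequality. The squared error has a finite integral, so late increases of
  G are small in total, whereas G loses a fixed amount per unit of time as long as it stays above a
  positive level.\<close>

lemma Vitali_covering_intervals:
  fixes S :: "real set"
  assumes S: "S \<in> sets borel"
    and cov: "\<And>x d. x \<in> S \<Longrightarrow> 0 < d \<Longrightarrow> \<exists>u v. u < x \<and> x < v \<and> v - u < d \<and> P u v"
  obtains C :: "(real \<times> real) set" where "countable C"
    "\<forall>i\<in>C. fst i < snd i \<and> P (fst i) (snd i)"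
    "disjoint_family_on (\<lambda>i. {fst i..snd i}) C"
    "emeasure lborel (S - (\<Union>i\<in>C. {fst i<..<snd i})) = 0"
proof -
  define K where "K = {i::real\<times>real. fst i < snd i \<and> P (fst i) (snd i)}"
  define a where "a = (\<lambda>i::real\<times>real. (fst i + snd i) / 2)"
  define r where "r = (\<lambda>i::real\<times>real. (snd i - fst i) / 2)"
  have cb: "cball (a i) (r i) = {fst i..snd i}" for i
    unfolding cball_eq_atLeastAtMost a_def r_def by (auto simp: field_simps)
  have "\<exists>i. i \<in> K \<and> x \<in> cball (a i) (r i) \<and> r i < d" if xd: "x \<in> S" "0 < d" for x d
  proof -
    obtain u v where "u < x" "x < v" "v - u < d" "P u v"
      using cov[OF xd] by blast
    then show ?thesis
      unfolding cb by (intro exI[of _ "(u,v)"]) (auto simp: K_def r_def)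
  qed
  moreover have "0 < r i" if "i \<in> K" for i
    using that by (auto simp: K_def r_def)
  ultimately obtain C where C: "countable C" "C \<subseteq> K"
    "pairwise (\<lambda>i j. disjnt (cball (a i) (r i)) (cball (a j) (r j))) C"
    "negligible (S - (\<Union>i \<in> C. cball (a i) (r i)))"
    using Vitali_covering_theorem_cballs[of K r S a] by blast
  let ?N = "S - (\<Union>i\<in>C. {fst i<..<snd i})"
  \<comment> \<open>The covering theorem provides closed balls; passing to open intervals loses only
    endpoints, and there are countably many of them.\<close>
  have "negligible (fst ` C \<union> snd ` C)"
    using C(1) by (auto simp: negligible_iff_null_sets intro!: null_sets_completionI countable_imp_null_set_lborel)
  then have "negligible ((S - (\<Union>i \<in> C. cball (a i) (r i))) \<union> (fst ` C \<union> snd ` C))"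
    using C(4) negligible_Un by blast
  moreover have "?N \<subseteq> (S - (\<Union>i \<in> C. cball (a i) (r i))) \<union> (fst ` C \<union> snd ` C)"
    unfolding cb by (force simp: not_less)
  ultimately have "negligible ?N"
    using negligible_subset by blast
  moreover have "?N \<in> sets borel"
    using S by (intro sets.Diff[OF _ borel_open] open_UN) auto
  ultimately have "emeasure lborel ?N = 0"
    by (simp add: negligible_iff_null_sets null_sets_completion_iff null_setsD1)
  moreover have "disjoint_family_on (\<lambda>i. {fst i..snd i}) C"
    using C(3) unfolding disjoint_family_on_def pairwise_def disjnt_def cb by blast
  ultimately show thesis
    using that[of C] C(1,2) by (auto simp: K_def)
qed

text \<open>Vitali selects disjoint intervals that cover almost all of \<open>E\<close> and on which
  \<open>f\<close> rises by more than \<open>q\<close> times the length. Monotonicity keeps their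
  images non-overlapping inside \<open>{f a..f b}\<close>, so the rises add up to at most
  \<open>f b - f a\<close>. The images are taken open because neighbouring ones may share an
  endpoint.\<close>

lemma mono_emeasure_large_slope_le:
  fixes f :: "real \<Rightarrow> real"
  assumes "mono f" and E: "E \<in> sets borel" "E \<subseteq> {a<..<b}" and "a < b" "0 < q"
    and up: "\<And>x d. x \<in> E \<Longrightarrow> 0 < d \<Longrightarrow> \<exists>u v. u < x \<and> x < v \<and> v - u < d \<and> q * (v - u) < f v - f u"
  shows "ennreal q * emeasure lborel E \<le> ennreal (f b - f a)"
proof -
  have "\<exists>u v. u < x \<and> x < v \<and> v - u < d \<and> a \<le> u \<and> v \<le> b \<and> q * (v - u) < f v - f u"
    if "x \<in> E" "0 < d" for x d
  proof -
    have "0 < min d (min (x - a) (b - x))"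
      using that E by auto
    from up[OF that(1) this] obtain u v where "u < x" "x < v" "v - u < min d (min (x - a) (b - x))" "q * (v - u) < f v - f u"
      by blast
    then show ?thesis
      by (intro exI[of _ u] exI[of _ v]) auto
  qed
  then obtain C where C: "countable C"
    "\<forall>i\<in>C. fst i < snd i \<and> a \<le> fst i \<and> snd i \<le> b \<and> q * (snd i - fst i) < f (snd i) - f (fst i)"
    "disjoint_family_on (\<lambda>i. {fst i..snd i}) C"
    "emeasure lborel (E - (\<Union>i\<in>C. {fst i<..<snd i})) = 0"
    by (rule Vitali_covering_intervals[OF E(1), where P="\<lambda>u v. a \<le> u \<and> v \<le> b \<and> q * (v - u) < f v - f u"]) blast
  have d1: "disjoint_family_on (\<lambda>i. {fst i<..<snd i}) C"
    using C(3) unfolding disjoint_family_on_def by fastforce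
  have d2: "disjoint_family_on (\<lambda>i. {f (fst i)<..<f (snd i)}) C"
    unfolding disjoint_family_on_def
  proof (intro ballI impI)
    fix i j assume ij: "i \<in> C" "j \<in> C" "i \<noteq> j"
    then have "{fst i..snd i} \<inter> {fst j..snd j} = {}"
      using C(3) unfolding disjoint_family_on_def by blast
    then have "snd i < fst j \<or> snd j < fst i"
      using C(2)[rule_format, OF ij(1)] C(2)[rule_format, OF ij(2)] by (auto simp: Int_atLeastAtMost)
    then have "f (snd i) \<le> f (fst j) \<or> f (snd j) \<le> f (fst i)"
      using \<open>mono f\<close> by (meson less_imp_le monoD)
    then show "{f (fst i)<..<f (snd i)} \<inter> {f (fst j)<..<f (snd j)} = {}"
      by auto
  qed
  have mU: "(\<Union>i\<in>C. {fst i<..<snd i}) \<in> sets lborel"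
    by (simp add: borel_open open_UN)
  have "emeasure lborel E \<le> emeasure lborel ((E - (\<Union>i\<in>C. {fst i<..<snd i})) \<union> (\<Union>i\<in>C. {fst i<..<snd i}))"
    using E mU by (intro emeasure_mono) auto
  also have "\<dots> \<le> emeasure lborel (E - (\<Union>i\<in>C. {fst i<..<snd i})) + emeasure lborel (\<Union>i\<in>C. {fst i<..<snd i})"
    using E mU by (intro emeasure_subadditive) auto
  also have "\<dots> = (\<integral>\<^sup>+i. emeasure lborel {fst i<..<snd i} \<partial>count_space C)"
    unfolding C(4) using C(1) d1 by (subst emeasure_UN_countable) auto
  finally have "ennreal q * emeasure lborel E \<le> ennreal q * (\<integral>\<^sup>+i. emeasure lborel {fst i<..<snd i} \<partial>count_space C)"
    by (rule mult_left_mono) simp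
  also have "\<dots> = (\<integral>\<^sup>+i. ennreal q * emeasure lborel {fst i<..<snd i} \<partial>count_space C)"
    by (rule nn_integral_cmult[symmetric]) simp
  also have "\<dots> \<le> (\<integral>\<^sup>+i. emeasure lborel {f (fst i)<..<f (snd i)} \<partial>count_space C)"
  proof (rule nn_integral_mono)
    fix i assume "i \<in> space (count_space C)"
    then have i: "i \<in> C" by simp
    have "f (fst i) \<le> f (snd i)"
      using C(2)[rule_format, OF i] \<open>mono f\<close> by (simp add: monoD)
    then show "ennreal q * emeasure lborel {fst i<..<snd i} \<le> emeasure lborel {f (fst i)<..<f (snd i)}"
      using C(2)[rule_format, OF i] \<open>0 < q\<close> by (simp add: ennreal_mult[symmetric] ennreal_leI)
  qed
  also have "\<dots> = emeasure lborel (\<Union>i\<in>C. {f (fst i)<..<f (snd i)})"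
    using C(1) d2 by (subst emeasure_UN_countable) auto
  also have "\<dots> \<le> emeasure lborel {f a..f b}"
  proof (rule emeasure_mono)
    show "(\<Union>i\<in>C. {f (fst i)<..<f (snd i)}) \<subseteq> {f a..f b}"
    proof (rule UN_least)
      fix i assume "i \<in> C"
      then have "f a \<le> f (fst i)" "f (snd i) \<le> f b"
        using C(2) \<open>mono f\<close> by (simp_all add: monoD)
      then show "{f (fst i)<..<f (snd i)} \<subseteq> {f a..f b}" by auto
    qed
  qed simp
  also have "\<dots> = ennreal (f b - f a)"
    using \<open>a < b\<close> \<open>mono f\<close> by (simp add: monoD)
  finally show ?thesis .
qed

text \<open>Two nested coverings. \<open>E\<close> is covered inside a slightly larger open
  \<open>U\<close> by disjoint intervals of slope below \<open>p\<close>; within each of them the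
  large-slope estimate bounds \<open>q\<close> times the measure of the part of \<open>E\<close>
  there by the rise of \<open>f\<close>. Summing gives q |E| \<le> p |U|, hence q |E| \<le> p |E|,
  and |E| is finite.\<close>

lemma mono_two_slopes_null:
  fixes f :: "real \<Rightarrow> real"
  assumes "mono f" and E: "E \<in> sets borel" "bounded E" and "0 < p" "p < q"
    and up: "\<And>x d. x \<in> E \<Longrightarrow> 0 < d \<Longrightarrow> \<exists>u v. u < x \<and> x < v \<and> v - u < d \<and> q * (v - u) < f v - f u"
    and lo: "\<And>x d. x \<in> E \<Longrightarrow> 0 < d \<Longrightarrow> \<exists>u v. u < x \<and> x < v \<and> v - u < d \<and> f v - f u < p * (v - u)"
  shows "emeasure lborel E = 0"
proof -
  have fin: "emeasure lborel E < \<infinity>"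
    using E(2) by (rule emeasure_bounded_finite)
  have key: "ennreal q * emeasure lborel E \<le> ennreal p * (emeasure lborel E + ennreal e)" if "0 < e" for e :: real
  proof -
    obtain U where U: "open U" "E \<subseteq> U" "emeasure lborel (U - E) < e"
      using outer_regular_lborel[OF E(1) \<open>0 < e\<close>] by blast
    have "\<exists>u v. u < x \<and> x < v \<and> v - u < d \<and> {u..v} \<subseteq> U \<and> f v - f u < p * (v - u)"
      if xd: "x \<in> E" "0 < d" for x d
    proof -
      obtain e where e: "e > 0" "ball x e \<subseteq> U"
        using U \<open>x \<in> E\<close> by (meson open_contains_ball subsetD)
      then have "0 < min d e"
        using that by auto
      from lo[OF xd(1) this] obtain u v where uv: "u < x" "x < v" "v - u < min d e" "f v - f u < p * (v - u)"
        by blast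
      then have "{u..v} \<subseteq> ball x e"
        by (auto simp: dist_real_def)
      with uv e show ?thesis by (intro exI[of _ u] exI[of _ v]) auto
    qed
    then obtain C where C: "countable C"
      "\<forall>i\<in>C. fst i < snd i \<and> {fst i..snd i} \<subseteq> U \<and> f (snd i) - f (fst i) < p * (snd i - fst i)"
      "disjoint_family_on (\<lambda>i. {fst i..snd i}) C"
      "emeasure lborel (E - (\<Union>i\<in>C. {fst i<..<snd i})) = 0"
      by (rule Vitali_covering_intervals[OF E(1), where P="\<lambda>u v. {u..v} \<subseteq> U \<and> f v - f u < p * (v - u)"]) blast
    have d1: "disjoint_family_on (\<lambda>i. {fst i<..<snd i}) C"
      using C(3) unfolding disjoint_family_on_def by fastforce
    then have d2: "disjoint_family_on (\<lambda>i. E \<inter> {fst i<..<snd i}) C"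
      unfolding disjoint_family_on_def by blast
    have mU: "(\<Union>i\<in>C. {fst i<..<snd i}) \<in> sets lborel"
      by (simp add: borel_open open_UN)
    have mEU: "(\<Union>i\<in>C. E \<inter> {fst i<..<snd i}) \<in> sets lborel"
      using C(1) E by (intro sets.countable_UN'') auto
    have "emeasure lborel E \<le> emeasure lborel ((E - (\<Union>i\<in>C. {fst i<..<snd i})) \<union> (\<Union>i\<in>C. E \<inter> {fst i<..<snd i}))"
      using E mU mEU by (intro emeasure_mono) auto
    also have "\<dots> \<le> emeasure lborel (E - (\<Union>i\<in>C. {fst i<..<snd i})) + emeasure lborel (\<Union>i\<in>C. E \<inter> {fst i<..<snd i})"
      using E mU mEU by (intro emeasure_subadditive) auto
    also have "\<dots> = (\<integral>\<^sup>+i. emeasure lborel (E \<inter> {fst i<..<snd i}) \<partial>count_space C)"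
      unfolding C(4) using C(1) d2 E by (subst emeasure_UN_countable) auto
    finally have "ennreal q * emeasure lborel E \<le> ennreal q * (\<integral>\<^sup>+i. emeasure lborel (E \<inter> {fst i<..<snd i}) \<partial>count_space C)"
      by (rule mult_left_mono) simp
    also have "\<dots> = (\<integral>\<^sup>+i. ennreal q * emeasure lborel (E \<inter> {fst i<..<snd i}) \<partial>count_space C)"
      by (rule nn_integral_cmult[symmetric]) simp
    also have "\<dots> \<le> (\<integral>\<^sup>+i. ennreal p * emeasure lborel {fst i<..<snd i} \<partial>count_space C)"
    proof (rule nn_integral_mono)
      fix i assume "i \<in> space (count_space C)"
      then have i: "i \<in> C" by simp
      have "ennreal q * emeasure lborel (E \<inter> {fst i<..<snd i}) \<le> ennreal (f (snd i) - f (fst i))"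
        using C(2)[rule_format, OF i] E assms(4,5) up
        by (intro mono_emeasure_large_slope_le[OF \<open>mono f\<close>]) auto
      also have "\<dots> \<le> ennreal (p * (snd i - fst i))"
        using C(2)[rule_format, OF i] by (intro ennreal_leI) auto
      finally show "ennreal q * emeasure lborel (E \<inter> {fst i<..<snd i}) \<le> ennreal p * emeasure lborel {fst i<..<snd i}"
        using C(2)[rule_format, OF i] \<open>0 < p\<close> by (simp add: ennreal_mult)
    qed
    also have "\<dots> = ennreal p * (\<integral>\<^sup>+i. emeasure lborel {fst i<..<snd i} \<partial>count_space C)"
      by (rule nn_integral_cmult) simp
    also have "\<dots> = ennreal p * emeasure lborel (\<Union>i\<in>C. {fst i<..<snd i})"
      using C(1) d1 by (subst emeasure_UN_countable) auto
    also have "\<dots> \<le> ennreal p * emeasure lborel (E \<union> (U - E))"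
    proof (intro mult_left_mono emeasure_mono)
      show "(\<Union>i\<in>C. {fst i<..<snd i}) \<subseteq> E \<union> (U - E)"
      proof (rule UN_least)
        fix i assume "i \<in> C"
        then have "{fst i..snd i} \<subseteq> U" using C(2) by blast
        then show "{fst i<..<snd i} \<subseteq> E \<union> (U - E)" by fastforce
      qed
    qed (use E U in auto)
    also have "\<dots> \<le> ennreal p * (emeasure lborel E + emeasure lborel (U - E))"
      using E U by (intro mult_left_mono emeasure_subadditive) auto
    also have "\<dots> \<le> ennreal p * (emeasure lborel E + ennreal e)"
      using U(3) by (intro mult_left_mono add_left_mono) auto
    finally show ?thesis .
  qed
  define m where "m = measure lborel E"
  have m: "emeasure lborel E = ennreal m" "0 \<le> m"
    using fin by (simp_all add: m_def emeasure_eq_ennreal_measure)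
  have le: "q * m \<le> p * (m + e)" if "0 < e" for e
    using key[OF that] that m assms(4,5) by (simp add: ennreal_mult[symmetric] ennreal_plus[symmetric] del: ennreal_plus)
  have "q * m \<le> p * m + e" if "0 < e" for e
    using le[of "e / p"] that \<open>0 < p\<close> by (simp add: distrib_left)
  then have "q * m \<le> p * m"
    by (rule field_le_epsilon)
  then have "m = 0"
    using m(2) assms(5) by (smt (verit) mult_right_mono mult_strict_right_mono)
  then show ?thesis using m by simp
qed

text \<open>The difference quotient is taken over intervals strictly straddling \<open>x\<close>, so
  \<open>x\<close> enters only through u < x < v. The steep points therefore form a countable
  intersection of open sets, whatever \<open>f\<close> is. Applied to \<open>- f\<close> and
  \<open>- p\<close>, the notion expresses arbitrarily short straddling intervals of slope below
  \<open>p\<close>.\<close>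

definition steep_at :: "(real \<Rightarrow> real) \<Rightarrow> real \<Rightarrow> real \<Rightarrow> bool" where
  "steep_at f q x \<longleftrightarrow> (\<forall>d>0. \<exists>u v. u < x \<and> x < v \<and> v - u < d \<and> q * (v - u) < f v - f u)"

lemma not_steep_atD:
  "\<not> steep_at f q x \<Longrightarrow>
    \<exists>d>0. \<forall>u v. u < x \<longrightarrow> x < v \<longrightarrow> v - u < d \<longrightarrow> f v - f u \<le> q * (v - u)"
  unfolding steep_at_def not_less[symmetric] by blast

lemma steep_at_borel: "{x. steep_at f q x} \<in> sets borel"
proof -
  have "{x. steep_at f q x} =
    (\<Inter>n::nat. \<Union>i\<in>{i. snd i - fst i < 1 / Suc n \<and> q * (snd i - fst i) < f (snd i) - f (fst i)}. {fst i<..<snd i})"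
    (is "_ = ?R")
  proof (intro equalityI subsetI)
    fix x assume "x \<in> {x. steep_at f q x}"
    then have *: "\<forall>d>0. \<exists>u v. u < x \<and> x < v \<and> v - u < d \<and> q * (v - u) < f v - f u"
      by (simp add: steep_at_def)
    have "\<exists>u v. u < x \<and> x < v \<and> v - u < 1 / Suc n \<and> q * (v - u) < f v - f u" for n
      using *[rule_format, of "1 / Suc n"] by simp
    then show "x \<in> ?R" by fastforce
  next
    fix x assume x: "x \<in> ?R"
    have "\<exists>u v. u < x \<and> x < v \<and> v - u < d \<and> q * (v - u) < f v - f u" if d: "d > 0" for d
    proof -
      obtain n where n: "inverse (real (Suc n)) < d"
        using reals_Archimedean[OF d] by blast
      from x obtain i where "snd i - fst i < 1 / Suc n" "q * (snd i - fst i) < f (snd i) - f (fst i)"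
        "x \<in> {fst i<..<snd i}"
        by fastforce
      with n show ?thesis
        by (intro exI[of _ "fst i"] exI[of _ "snd i"]) (auto simp: divide_inverse)
    qed
    then show "x \<in> {x. steep_at f q x}" by (simp add: steep_at_def)
  qed
  also have "\<dots> \<in> sets borel"
    by (intro sets.countable_INT'' borel_open open_UN) auto
  finally show ?thesis .
qed

text \<open>At a continuity point one endpoint of a straddling interval can be moved to
  \<open>x\<close>, which turns straddling quotients into ordinary ones.\<close>

lemma slope_bound_at_point:
  fixes f :: "real \<Rightarrow> real"
  assumes "isCont f x" and "\<And>u v. u < x \<Longrightarrow> x < v \<Longrightarrow> v - u < d \<Longrightarrow> f v - f u \<le> q * (v - u)"
    and "y \<noteq> x" "\<bar>y - x\<bar> < d"
  shows "(f y - f x) / (y - x) \<le> q"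
proof (cases "x < y")
  case True
  have "(f \<longlongrightarrow> f x) (at_left x)"
    using assms(1) by (simp add: isCont_def filterlim_at_split)
  then have lim: "((\<lambda>u. f y - f u) \<longlongrightarrow> f y - f x) (at_left x)" "((\<lambda>u. q * (y - u)) \<longlongrightarrow> q * (y - x)) (at_left x)"
    by (auto intro!: tendsto_intros)
  have ev: "\<forall>\<^sub>F u in at_left x. f y - f u \<le> q * (y - u)"
    using eventually_at_left[of "y - d" x] assms True by (auto intro!: exI[of _ "y - d"])
  have "f y - f x \<le> q * (y - x)"
    by (rule tendsto_le[OF trivial_limit_at_left_real lim(2,1) ev])
  with True show ?thesis by (simp add: field_simps)
next
  case False
  then have "y < x" using assms by simp
  have "(f \<longlongrightarrow> f x) (at_right x)"
    using assms(1) by (simp add: isCont_def filterlim_at_split)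
  then have lim: "((\<lambda>u. f u - f y) \<longlongrightarrow> f x - f y) (at_right x)" "((\<lambda>u. q * (u - y)) \<longlongrightarrow> q * (x - y)) (at_right x)"
    by (auto intro!: tendsto_intros)
  have ev: "\<forall>\<^sub>F u in at_right x. f u - f y \<le> q * (u - y)"
    using eventually_at_right[of x "y + d"] assms \<open>y < x\<close> by (auto intro!: exI[of _ "y + d"])
  have "f x - f y \<le> q * (x - y)"
    by (rule tendsto_le[OF trivial_limit_at_right_real lim(2,1) ev])
  with \<open>y < x\<close> show ?thesis by (simp add: field_simps)
qed

lemma mono_differentiable_criterion:
  fixes f :: "real \<Rightarrow> real"
  assumes "mono f" "isCont f x" "\<not> steep_at f (real (Suc m)) x"
    and sep: "\<And>p q. p \<in> \<rat> \<Longrightarrow> q \<in> \<rat> \<Longrightarrow> 0 < p \<Longrightarrow> p < q \<Longrightarrow> \<not> (steep_at f q x \<and> steep_at (\<lambda>x. - f x) (- p) x)"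
  shows "f differentiable (at x)"
proof -
  \<comment> \<open>The infimum of the non-steep levels is the candidate derivative. Restricting to
    positive levels bounds \<open>Q\<close> below and costs nothing for monotone
    \<open>f\<close>.\<close>
  define Q where "Q = {q. 0 < q \<and> \<not> steep_at f q x}"
  have Q: "Q \<noteq> {}" "bdd_below Q"
    using assms(3) unfolding Q_def by (fastforce, intro bdd_belowI[of _ 0]) auto
  define D where "D = Inf Q"
  have up: "\<exists>d>0. \<forall>y. y \<noteq> x \<and> \<bar>y - x\<bar> < d \<longrightarrow> (f y - f x) / (y - x) < D + e" if e: "0 < e" for e
  proof -
    obtain q where q: "q \<in> Q" "q < D + e"
      using Q e cInf_less_iff[of Q "D + e"] unfolding D_def by auto
    then have "\<exists>d>0. \<forall>u v. u < x \<longrightarrow> x < v \<longrightarrow> v - u < d \<longrightarrow> f v - f u \<le> q * (v - u)"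
      by (intro not_steep_atD) (simp add: Q_def)
    then obtain d where d: "0 < d" "\<And>u v. u < x \<Longrightarrow> x < v \<Longrightarrow> v - u < d \<Longrightarrow> f v - f u \<le> q * (v - u)"
      by blast
    show ?thesis
      using slope_bound_at_point[OF assms(2), of d q] d q by (intro exI[of _ d]) force
  qed
  have lo: "\<exists>d>0. \<forall>y. y \<noteq> x \<and> \<bar>y - x\<bar> < d \<longrightarrow> D - e < (f y - f x) / (y - x)" if e: "0 < e" for e
  proof (cases "D - e < 0")
    case True
    have "0 \<le> (f y - f x) / (y - x)" if "y \<noteq> x" for y
      using \<open>mono f\<close> by (cases "x < y") (simp_all add: monoD zero_le_divide_iff)
    with True show ?thesis by (intro exI[of _ 1]) force
  next
    case False
    \<comment> \<open>With D - e < p < q < D, the level \<open>q\<close> lies below the infimum of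
      \<open>Q\<close>, so \<open>x\<close> is steep at \<open>q\<close>; \<open>sep\<close> then
      forbids slopes below \<open>p\<close> near \<open>x\<close>.\<close>
    obtain p where p: "p \<in> \<rat>" "D - e < p" "p < D"
      using Rats_dense_in_real[of "D - e" D] e by auto
    obtain q where q: "q \<in> \<rat>" "p < q" "q < D"
      using Rats_dense_in_real[of p D] p by auto
    have "q \<notin> Q"
      using q Q(2) cInf_lower unfolding D_def by fastforce
    then have "steep_at f q x"
      using q p False by (auto simp: Q_def)
    then have "\<not> steep_at (\<lambda>x. - f x) (- p) x"
      using sep[of p q] p q False by auto
    then have "\<exists>d>0. \<forall>u v. u < x \<longrightarrow> x < v \<longrightarrow> v - u < d \<longrightarrow> - f v - - f u \<le> - p * (v - u)"
      by (rule not_steep_atD)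
    then obtain d where d: "0 < d" "\<And>u v. u < x \<Longrightarrow> x < v \<Longrightarrow> v - u < d \<Longrightarrow> - f v - - f u \<le> - p * (v - u)"
      by blast
    have "isCont (\<lambda>x. - f x) x" using assms(2) by (rule continuous_minus)
    from slope_bound_at_point[OF this, of d "-p"] d
    have "(- f y - - f x) / (y - x) \<le> - p" if "y \<noteq> x" "\<bar>y - x\<bar> < d" for y
      using that by auto
    moreover have "(- f y - - f x) / (y - x) = - ((f y - f x) / (y - x))" for y
      by (simp add: minus_divide_left)
    ultimately have "p \<le> (f y - f x) / (y - x)" if "y \<noteq> x" "\<bar>y - x\<bar> < d" for y
      using that by fastforce
    then show ?thesis using d(1) p(2) by (intro exI[of _ d]) force
  qed
  have "((\<lambda>y. (f y - f x) / (y - x)) \<longlongrightarrow> D) (at x)"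
  proof (rule order_tendstoI)
    fix a assume "a < D"
    then show "\<forall>\<^sub>F y in at x. a < (f y - f x) / (y - x)"
      using lo[of "D - a"] by (auto simp: eventually_at dist_real_def)
  next
    fix a assume "D < a"
    then show "\<forall>\<^sub>F y in at x. (f y - f x) / (y - x) < a"
      using up[of "a - D"] by (auto simp: eventually_at dist_real_def)
  qed
  then show ?thesis
    by (auto simp: real_differentiable_def has_field_derivative_iff)
qed

lemma AE_lborelI_bounded:
  assumes "{x::real. P x} \<in> sets borel" 
    and "\<And>k::nat. 0 < k \<Longrightarrow> emeasure lborel ({x. P x} \<inter> {- real k<..<real k}) = 0"
  shows "AE x in lborel. \<not> P x"
proof (rule AE_I)
  have eq: "{x. P x} = (\<Union>k\<in>{0<..}. {x. P x} \<inter> {- real k<..<real k})"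
  proof (intro equalityI subsetI)
    fix x assume x: "x \<in> {x. P x}"
    obtain k where "\<bar>x\<bar> < real k" using reals_Archimedean2 by blast
    with x show "x \<in> (\<Union>k\<in>{0<..}. {x. P x} \<inter> {- real k<..<real k})"
      by (intro UN_I[of k]) (auto intro: Nat.gr0I)
  qed auto
  have "emeasure lborel (\<Union>k\<in>{0<..}. {x. P x} \<inter> {- real k<..<real k}) = 0"
    using assms by (intro null_setsD1 null_sets_UN') (auto intro!: null_setsI)
  then show "emeasure lborel {x. P x} = 0"
    by (rule trans[OF arg_cong[where f="emeasure lborel", OF eq]])
qed (use assms in auto)

text \<open>Three null sets are removed: the countably many discontinuities; the points steep at
  every level, whose measure in a bounded window is at most a constant over m + 1 for every m; and,
  for each of the countably many pairs of rationals p < q, the points having both slopes above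
  \<open>q\<close> and slopes below \<open>p\<close> at all scales.\<close>

theorem mono_AE_differentiable:
  fixes f :: "real \<Rightarrow> real"
  assumes "mono f"
  shows "AE x in lborel. f differentiable (at x)"
proof -
  have "AE x in lborel. isCont f x"
    using countable_imp_null_set_lborel[OF mono_ctble_discont[OF assms]] by (auto intro!: AE_I'[of "{x. \<not> isCont f x}"])
  moreover have "AE x in lborel. \<not> (\<forall>m. steep_at f (real (Suc m)) x)"
  proof (rule AE_lborelI_bounded)
    have *: "{x. \<forall>m. steep_at f (real (Suc m)) x} = (\<Inter>m. {x. steep_at f (real (Suc m)) x})"
      by auto
    show m: "{x. \<forall>m. steep_at f (real (Suc m)) x} \<in> sets borel"
      unfolding * using steep_at_borel by (intro sets.countable_INT'') auto
    fix k :: nat assume "0 < k"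
    let ?E = "{x. \<forall>m. steep_at f (real (Suc m)) x} \<inter> {- real k<..<real k}"
    have le: "ennreal (real (Suc m)) * emeasure lborel ?E \<le> ennreal (f k - f (- k))" for m
      using m \<open>0 < k\<close>
      by (intro mono_emeasure_large_slope_le[OF assms]) (auto simp: steep_at_def)
    have "emeasure lborel ?E < \<infinity>"
      by (rule emeasure_bounded_finite) (simp add: bounded_Int)
    then have e: "emeasure lborel ?E = ennreal (measure lborel ?E)"
      by (intro emeasure_eq_ennreal_measure) auto
    have "real (Suc m) * measure lborel ?E \<le> f k - f (- k)" for m
      using le[of m] assms unfolding e by (simp add: ennreal_mult[symmetric] monoD del: of_nat_Suc)
    note bound = this
    have "measure lborel ?E \<le> 0"
    proof (rule ccontr)
      assume "\<not> measure lborel ?E \<le> 0"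
      then obtain m where "f k - f (- k) < real m * measure lborel ?E"
        using ex_less_of_nat_mult[of "measure lborel ?E" "f k - f (- k)"] by auto
      also have "\<dots> \<le> real (Suc m) * measure lborel ?E"
        by (intro mult_right_mono) auto
      finally show False using bound[of m] by simp
    qed
    then have "measure lborel ?E = 0" using measure_nonneg by (rule antisym)
    then show "emeasure lborel ?E = 0" using e by simp
  qed
  moreover have "AE x in lborel. \<forall>p\<in>\<rat>. \<forall>q\<in>\<rat>. 0 < p \<longrightarrow> p < q \<longrightarrow> \<not> (steep_at f q x \<and> steep_at (\<lambda>x. - f x) (- p) x)"
  proof -
    have "AE x in lborel. 0 < p \<longrightarrow> p < q \<longrightarrow> \<not> (steep_at f q x \<and> steep_at (\<lambda>x. - f x) (- p) x)" for p q
    proof (cases "0 < p \<and> p < q")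
      case True
      have "AE x in lborel. \<not> (steep_at f q x \<and> steep_at (\<lambda>x. - f x) (- p) x)"
      proof (rule AE_lborelI_bounded)
        show m: "{x. steep_at f q x \<and> steep_at (\<lambda>x. - f x) (- p) x} \<in> sets borel"
          using steep_at_borel[of f q] steep_at_borel[of "\<lambda>x. - f x" "- p"] by (simp add: Collect_conj_eq sets.Int)
        fix k :: nat
        show "emeasure lborel ({x. steep_at f q x \<and> steep_at (\<lambda>x. - f x) (- p) x} \<inter> {- real k<..<real k}) = 0"
          using m True
          by (intro mono_two_slopes_null[OF assms, of _ p q]) (auto simp: steep_at_def bounded_Int algebra_simps)
      qed
      then show ?thesis by eventually_elim auto
    qed auto
    then show ?thesis
      by (simp add: AE_ball_countable countable_rat)
  qed
  ultimately show ?thesis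
    by eventually_elim (use mono_differentiable_criterion[OF assms] in blast)
qed

section \<open>From absolute continuity to bounded variation\<close>

lemma abs_continuous_on_intervalD:
  assumes "abs_continuous_on_interval a b f" "0 < e"
  shows "\<exists>\<delta>>0. \<forall>(m::nat) u v. (\<forall>k<m. a \<le> u k \<and> u k \<le> v k \<and> v k \<le> b) \<longrightarrow>
        disjoint_family_on (\<lambda>k. {u k<..<v k}) {..<m} \<longrightarrow>
        (\<Sum>k<m. v k - u k) < \<delta> \<longrightarrow> (\<Sum>k<m. \<bar>f (v k) - f (u k)\<bar>) < e"
  using assms unfolding abs_continuous_on_interval_def by (simp only: conj_imp_eq_imp_imp imp_conjL)

lemma sum_lengths_disjoint_intervals_le:
  assumes "\<And>k. k < m \<Longrightarrow> c \<le> u k \<and> u k \<le> v k \<and> v k \<le> x"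
    and "disjoint_family_on (\<lambda>k. {u k<..<v k}) {..<m}" and "c \<le> x"
  shows "(\<Sum>k<(m::nat). v k - u k) \<le> x - (c::real)"
proof -
  have "ennreal (\<Sum>k<m. v k - u k) = (\<Sum>k<m. emeasure lborel {u k<..<v k})"
    using assms(1) by (subst sum_ennreal[symmetric]) auto
  also have "\<dots> = emeasure lborel (\<Union>k<m. {u k<..<v k})"
    using assms(2) by (intro sum_emeasure) auto
  also have "\<dots> \<le> emeasure lborel {c..x}"
    using assms(1) by (intro emeasure_mono) force+
  also have "\<dots> = ennreal (x - c)"
    using \<open>c \<le> x\<close> by simp
  finally show ?thesis
    using \<open>c \<le> x\<close> by (simp add: ennreal_le_iff)
qed

text \<open>The supremum of this set is the total variation on \<open>{c..x}\<close>. It uses the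
  same finite disjoint families as \<open>abs_continuous_on_interval\<close>, so a \<delta> from
  there bounds all sums over a short interval at once.\<close>

definition variation_sums :: "(real \<Rightarrow> real) \<Rightarrow> real \<Rightarrow> real \<Rightarrow> real set" where
  "variation_sums f c x = {s. \<exists>(m::nat) u v. (\<forall>k<m. c \<le> u k \<and> u k \<le> v k \<and> v k \<le> x) \<and>
     disjoint_family_on (\<lambda>k. {u k<..<v k}) {..<m} \<and> s = (\<Sum>k<m. \<bar>f (v k) - f (u k)\<bar>)}"

lemma variation_sums_nonempty: "0 \<in> variation_sums f c x"
  unfolding variation_sums_def by (auto intro!: exI[of _ 0] simp: disjoint_family_on_def)

lemma variation_sums_mono:
  assumes "x \<le> y"
  shows "variation_sums f c x \<subseteq> variation_sums f c y"
proof
  fix s assume "s \<in> variation_sums f c x"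
  then obtain m :: nat and u v where uv: "\<forall>k<m. c \<le> u k \<and> u k \<le> v k \<and> v k \<le> x"
    "disjoint_family_on (\<lambda>k. {u k<..<v k}) {..<m}" "s = (\<Sum>k<m. \<bar>f (v k) - f (u k)\<bar>)"
    unfolding variation_sums_def by blast
  have "\<forall>k<m. c \<le> u k \<and> u k \<le> v k \<and> v k \<le> y"
    using uv(1) assms order_trans by blast
  with uv(2,3) show "s \<in> variation_sums f c y"
    unfolding variation_sums_def by blast
qed

lemma variation_sums_extend:
  assumes "s \<in> variation_sums f c x" "c \<le> x" "x \<le> y"
  shows "s + \<bar>f y - f x\<bar> \<in> variation_sums f c y"
proof -
  obtain m :: nat and u v where uv: "\<And>k. k < m \<Longrightarrow> c \<le> u k \<and> u k \<le> v k \<and> v k \<le> x"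
    "disjoint_family_on (\<lambda>k. {u k<..<v k}) {..<m}" "s = (\<Sum>k<m. \<bar>f (v k) - f (u k)\<bar>)"
    using assms(1) unfolding variation_sums_def by blast
  have d: "disjoint_family_on (\<lambda>k. {(u(m := x)) k<..<(v(m := y)) k}) {..<Suc m}"
    unfolding disjoint_family_on_def
  proof (intro ballI impI)
    fix i j assume ij: "i \<in> {..<Suc m}" "j \<in> {..<Suc m}" "i \<noteq> j"
    have *: "{u k<..<v k} \<inter> {x<..<y} = {}" if "k < m" for k
      using uv(1)[OF that] by auto
    consider "i < m" "j < m" | "i = m" "j < m" | "i < m" "j = m"
      using ij by fastforce
    then show "{(u(m := x)) i<..<(v(m := y)) i} \<inter> {(u(m := x)) j<..<(v(m := y)) j} = {}"
      using uv(2) ij(3) * unfolding disjoint_family_on_def by cases (auto simp: Int_commute)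
  qed
  have "(\<Sum>k<m. \<bar>f ((v(m := y)) k) - f ((u(m := x)) k)\<bar>) = s"
    unfolding uv(3) by (intro sum.cong) auto
  then have "(\<Sum>k<Suc m. \<bar>f ((v(m := y)) k) - f ((u(m := x)) k)\<bar>) = s + \<bar>f y - f x\<bar>"
    by simp
  moreover have "\<forall>k<Suc m. c \<le> (u(m := x)) k \<and> (u(m := x)) k \<le> (v(m := y)) k \<and> (v(m := y)) k \<le> y"
    using uv(1) assms(2,3) by (auto simp: less_Suc_eq intro: order_trans)
  ultimately show ?thesis
    using d unfolding variation_sums_def
    by (intro CollectI exI[of _ "Suc m"] exI[of _ "u(m := x)"] exI[of _ "v(m := y)"]) auto
qed

text \<open>Jordan decomposition: with \<open>V\<close> the variation function, V + f and V - f are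
  monotone, and f is half their difference.\<close>

lemma bounded_variation_AE_differentiable:
  assumes "c < d" and bdd: "bdd_above (variation_sums f c d)"
  shows "AE x in lborel. c < x \<and> x < d \<longrightarrow> f differentiable (at x)"
proof -
  define V where "V = (\<lambda>x. Sup (variation_sums f c x))"
  \<comment> \<open>Clamping to \<open>{c..d}\<close> makes both functions monotone on the whole
    line and changes nothing near interior points.\<close>
  define cl where "cl = (\<lambda>x. max c (min d x))"
  have cl: "c \<le> cl x" "cl x \<le> d" for x
    using \<open>c < d\<close> by (auto simp: cl_def)
  have cl_mono: "cl x \<le> cl y" if "x \<le> y" for x y
    using that by (auto simp: cl_def)
  have bdd': "bdd_above (variation_sums f c x)" if "x \<le> d" for x
    by (rule bdd_above_mono[OF bdd variation_sums_mono[OF that]])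
  have V: "\<bar>f y - f x\<bar> \<le> V y - V x" if "c \<le> x" "x \<le> y" "y \<le> d" for x y
  proof -
    have "V x \<le> V y - \<bar>f y - f x\<bar>"
      unfolding V_def
    proof (rule cSup_least)
      fix s assume "s \<in> variation_sums f c x"
      then have "s + \<bar>f y - f x\<bar> \<le> Sup (variation_sums f c y)"
        using variation_sums_extend that bdd' by (intro cSup_upper) auto
      then show "s \<le> Sup (variation_sums f c y) - \<bar>f y - f x\<bar>" by simp
    qed (use variation_sums_nonempty in blast)
    then show ?thesis by simp
  qed
  have V': "\<bar>f (cl y) - f (cl x)\<bar> \<le> V (cl y) - V (cl x)" if "x \<le> y" for x y
    using V cl cl_mono[OF that] by blast
  have "mono (\<lambda>x. V (cl x) + f (cl x))" "mono (\<lambda>x. V (cl x) - f (cl x))"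
    using V' by (auto intro!: monoI) (smt (verit))+
  then have "AE x in lborel. (\<lambda>x. V (cl x) + f (cl x)) differentiable (at x)"
    "AE x in lborel. (\<lambda>x. V (cl x) - f (cl x)) differentiable (at x)"
    using mono_AE_differentiable by blast+
  then show ?thesis
  proof eventually_elim
    case (elim x)
    show ?case
    proof (intro impI)
      assume x: "c < x \<and> x < d"
      have "(\<lambda>x. ((V (cl x) + f (cl x)) - (V (cl x) - f (cl x))) / 2) differentiable (at x)"
        by (rule differentiable_divide[OF differentiable_diff[OF elim] differentiable_const]) simp
      also have "(\<lambda>x. ((V (cl x) + f (cl x)) - (V (cl x) - f (cl x))) / 2) = (\<lambda>x. f (cl x))"
        by (rule ext) (simp add: field_simps)
      finally have "(\<lambda>x. f (cl x)) differentiable (at x)" .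
      then obtain D where "((\<lambda>x. f (cl x)) has_derivative D) (at x)"
        by (auto simp: differentiable_def)
      then have "(f has_derivative D) (at x)"
        by (rule has_derivative_transform_within_open[OF _ open_greaterThanLessThan[of c d]])
          (use x in \<open>auto simp: cl_def\<close>)
      then show "f differentiable (at x)" by (auto simp: differentiable_def)
    qed
  qed
qed

text \<open>On an interval shorter than the \<delta> belonging to \<epsilon> = 1 every variation sum
  is at most 1. Such intervals with rational endpoints are countably many and cover the open
  interval from 0 to \<open>T\<close>.\<close>

theorem abs_continuous_AE_differentiable:
  assumes "abs_continuous_on_interval 0 T f"
  shows "AE x in lborel. 0 < x \<and> x < T \<longrightarrow> f differentiable (at x)"
proof -
  obtain \<delta> where "\<delta> > 0" and \<delta>: "\<forall>(m::nat) u v. (\<forall>k<m. 0 \<le> u k \<and> u k \<le> v k \<and> v k \<le> T) \<longrightarrow>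
        disjoint_family_on (\<lambda>k. {u k<..<v k}) {..<m} \<longrightarrow>
        (\<Sum>k<m. v k - u k) < \<delta> \<longrightarrow> (\<Sum>k<m. \<bar>f (v k) - f (u k)\<bar>) < 1"
    using abs_continuous_on_intervalD[OF assms zero_less_one] by blast
  have "AE x in lborel. c < x \<and> x < d \<longrightarrow> f differentiable (at x)"
    if cd: "0 \<le> c" "c < d" "d \<le> T" "d - c < \<delta>" for c d
  proof (rule bounded_variation_AE_differentiable)
    have "s \<le> 1" if s: "s \<in> variation_sums f c d" for s
    proof -
      obtain m :: nat and u v where uv: "\<And>k. k < m \<Longrightarrow> c \<le> u k \<and> u k \<le> v k \<and> v k \<le> d"
        "disjoint_family_on (\<lambda>k. {u k<..<v k}) {..<m}" "s = (\<Sum>k<m. \<bar>f (v k) - f (u k)\<bar>)"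
        using s unfolding variation_sums_def by blast
      have "(\<Sum>k<m. v k - u k) \<le> d - c"
        using uv cd by (intro sum_lengths_disjoint_intervals_le) auto
      show ?thesis
      proof -
        have "\<forall>k<m. 0 \<le> u k \<and> u k \<le> v k \<and> v k \<le> T"
          using uv(1) cd by (meson order_trans)
        then show ?thesis
          unfolding uv(3) using uv(2) cd \<open>_ \<le> d - c\<close> by (intro less_imp_le \<delta>[rule_format]) auto
      qed
    qed
    then show "bdd_above (variation_sums f c d)" by (rule bdd_aboveI)
  qed (use cd in auto)
  then have "AE x in lborel. \<forall>c\<in>\<rat>. \<forall>d\<in>\<rat>. 0 \<le> c \<longrightarrow> c < d \<longrightarrow> d \<le> T \<longrightarrow> d - c < \<delta> \<longrightarrow>
      c < x \<and> x < d \<longrightarrow> f differentiable (at x)"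
    by (simp add: AE_ball_countable countable_rat)
  then show ?thesis
  proof eventually_elim
    case (elim x)
    show ?case
    proof
      assume x: "0 < x \<and> x < T"
      obtain c where c: "c \<in> \<rat>" "max 0 (x - \<delta> / 2) < c" "c < x"
        using Rats_dense_in_real[of "max 0 (x - \<delta> / 2)" x] x \<open>\<delta> > 0\<close> by auto
      obtain d where d: "d \<in> \<rat>" "x < d" "d < min T (x + \<delta> / 2)"
        using Rats_dense_in_real[of x "min T (x + \<delta> / 2)"] x \<open>\<delta> > 0\<close> by auto
      show "f differentiable (at x)"
        using elim c d by auto
    qed
  qed
qed

text \<open>The increments over intervals tagged at regular points are controlled by the derivative, those
  over intervals tagged in the exceptional null set by absolute continuity.\<close>

theorem abs_continuous_increment_le_integral:
  fixes F h :: "real \<Rightarrow> real"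
  assumes ac: "abs_continuous_on_interval 0 T F" and ab: "0 \<le> a" "a \<le> b" "b \<le> T"
    and h: "(h has_integral I) {a..b}"
    and AE: "AE x in lborel. x \<in> {a<..<b} \<longrightarrow> (\<exists>D. (F has_real_derivative D) (at x) \<and> D \<le> h x)"
  shows "F b - F a \<le> I"
proof -
  obtain N0 where N0: "{x. \<not> (x \<in> {a<..<b} \<longrightarrow> (\<exists>D. (F has_real_derivative D) (at x) \<and> D \<le> h x))} \<subseteq> N0"
    "emeasure lborel N0 = 0" "N0 \<in> sets lborel"
    using AE by (auto elim!: AE_E)
  \<comment> \<open>The derivative bound is assumed on the open interval only, so the endpoints join
    the exceptional set.\<close>
  define N where "N = N0 \<union> {a, b}"
  have "N0 \<in> null_sets lborel" "{a, b} \<in> null_sets lborel"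
    using N0 finite_imp_null_set_lborel[of "{a, b}"] by (simp_all add: null_sets_def)
  then have "N \<in> null_sets lborel"
    unfolding N_def by (rule null_sets.Un)
  then have N: "N \<in> sets lborel" "emeasure lborel N = 0"
    by auto
  have der: "\<exists>D. (F has_real_derivative D) (at x) \<and> D \<le> h x" if "x \<in> {a..b} - N" for x
  proof -
    from that have "x \<in> {a<..<b}" "x \<notin> N0" by (auto simp: N_def)
    then show ?thesis using N0(1) by blast
  qed
  \<comment> \<open>The integral is unchanged, and cells tagged in \<open>N\<close> now contribute
    nothing to Riemann sums.\<close>
  define h0 where "h0 = (\<lambda>x. if x \<in> N then 0 else h x)"
  have h0: "(h0 has_integral I) {a..b}"
  proof (rule has_integral_spike[OF _ _ h])
    show "negligible N"
      using N by (simp add: negligible_iff_null_sets null_sets_completionI null_setsI)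
  qed (auto simp: h0_def)
  \<comment> \<open>The slack is e * (b - a) from comparing increments with slopes
    \<open>h0 x + e\<close>, one e from the Riemann sum of \<open>h0\<close>, and one e from the
    cells tagged in \<open>N\<close>.\<close>
  have "F b - F a \<le> I + e * (b - a + 2)" if "0 < e" for e
  proof -
    obtain \<delta> where "\<delta> > 0" and \<delta>: "\<forall>(m::nat) u v. (\<forall>k<m. 0 \<le> u k \<and> u k \<le> v k \<and> v k \<le> T) \<longrightarrow>
        disjoint_family_on (\<lambda>k. {u k<..<v k}) {..<m} \<longrightarrow>
        (\<Sum>k<m. v k - u k) < \<delta> \<longrightarrow> (\<Sum>k<m. \<bar>F (v k) - F (u k)\<bar>) < e"
      using abs_continuous_on_intervalD[OF ac \<open>0 < e\<close>] by blast
    have "N \<in> sets borel" using N by simp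
    then obtain U where U: "open U" "N \<subseteq> U" "emeasure lborel (U - N) < ennreal \<delta>"
      using outer_regular_lborel[of N \<delta>] \<open>\<delta> > 0\<close> by blast
    have Um: "emeasure lborel U < ennreal \<delta>"
    proof -
      have "emeasure lborel U = emeasure lborel (N \<union> (U - N))"
        using U(2) by (simp add: Un_absorb1)
      also have "\<dots> \<le> emeasure lborel N + emeasure lborel (U - N)"
        using N U(1) by (intro emeasure_subadditive) auto
      finally show ?thesis using U(3) N(2) by simp
    qed
    have e1: "\<exists>d>0. ball x d \<subseteq> U" if "x \<in> N" for x
      using U that by (meson open_contains_ball subsetD)
    have e2: "\<exists>d>0. \<forall>u v. u \<le> x \<and> x \<le> v \<and> {u..v} \<subseteq> ball x d \<longrightarrow> F v - F u \<le> (h0 x + e) * (v - u)"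
      if x: "x \<in> {a..b} - N" for x
    proof -
      obtain D where D: "(F has_real_derivative D) (at x)" "D \<le> h x"
        using der[OF x] by blast
      then have "((\<lambda>y. (F y - F x) / (y - x)) \<longlongrightarrow> D) (at x)"
        by (simp add: has_field_derivative_iff)
      then have "\<forall>\<^sub>F y in at x. (F y - F x) / (y - x) < D + e"
        using \<open>0 < e\<close> by (intro order_tendstoD) auto
      then obtain d where d: "0 < d" "\<And>y. y \<noteq> x \<Longrightarrow> dist y x < d \<Longrightarrow> (F y - F x) / (y - x) < D + e"
        by (auto simp: eventually_at)
      have "F v - F u \<le> (h0 x + e) * (v - u)" if uv: "u \<le> x \<and> x \<le> v \<and> {u..v} \<subseteq> ball x d" for u v
      proof -
        have "u \<in> {u..v}" "v \<in> {u..v}" using uv by auto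
        then have "u \<in> ball x d" "v \<in> ball x d" using uv by blast+
        then have "dist u x < d" and "dist v x < d" by (auto simp: dist_commute)
        have "F v - F x \<le> (D + e) * (v - x)"
        proof (cases "v = x")
          case False
          with d(2)[of v] \<open>dist v x < d\<close> uv show ?thesis
            by (simp add: pos_divide_less_eq)
        qed simp
        moreover have "F x - F u \<le> (D + e) * (x - u)"
        proof (cases "u = x")
          case False
          with d(2)[of u] \<open>dist u x < d\<close> uv have "(D + e) * (u - x) < F u - F x"
            by (simp add: neg_divide_less_eq)
          then show ?thesis by (simp add: algebra_simps)
        qed simp
        ultimately have "F v - F u \<le> (D + e) * (v - u)"
          by (simp add: algebra_simps)
        also have "\<dots> \<le> (h0 x + e) * (v - u)"
          using D x uv by (intro mult_right_mono) (auto simp: h0_def)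
        finally show ?thesis .
      qed
      with d(1) show ?thesis by blast
    qed
    \<comment> \<open>One radius function serves both kinds of tags: cells tagged in
      \<open>N\<close> stay inside \<open>U\<close>, whose measure is below \<delta>, and the other
      cells are short enough for the derivative estimate.\<close>
    have "\<exists>d>0. (x \<in> N \<longrightarrow> ball x d \<subseteq> U) \<and> (x \<in> {a..b} - N \<longrightarrow>
        (\<forall>u v. u \<le> x \<and> x \<le> v \<and> {u..v} \<subseteq> ball x d \<longrightarrow> F v - F u \<le> (h0 x + e) * (v - u)))" for x
    proof -
      consider "x \<in> N" | "x \<in> {a..b} - N" | "x \<notin> N" "x \<notin> {a..b} - N" by blast
      then show ?thesis
        by cases (use e1 e2 zero_less_one in blast)+
    qed
    then have "\<forall>x. \<exists>d. 0 < d \<and> (x \<in> N \<longrightarrow> ball x d \<subseteq> U) \<and> (x \<in> {a..b} - N \<longrightarrow>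
        (\<forall>u v. u \<le> x \<and> x \<le> v \<and> {u..v} \<subseteq> ball x d \<longrightarrow> F v - F u \<le> (h0 x + e) * (v - u)))"
      by blast
    then obtain d where d0: "\<forall>x. 0 < d x \<and> (x \<in> N \<longrightarrow> ball x (d x) \<subseteq> U) \<and> (x \<in> {a..b} - N \<longrightarrow>
        (\<forall>u v. u \<le> x \<and> x \<le> v \<and> {u..v} \<subseteq> ball x (d x) \<longrightarrow> F v - F u \<le> (h0 x + e) * (v - u)))"
      by (rule choice[THEN exE])
    have d: "0 < d x" "x \<in> N \<Longrightarrow> ball x (d x) \<subseteq> U"
      "x \<in> {a..b} - N \<Longrightarrow> u \<le> x \<Longrightarrow> x \<le> v \<Longrightarrow> {u..v} \<subseteq> ball x (d x) \<Longrightarrow> F v - F u \<le> (h0 x + e) * (v - u)" for x u v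
      using d0 by blast+
    have g1: "gauge (\<lambda>x. ball x (d x))"
      using d(1) by (rule gauge_ball_dependent[rule_format])
    obtain g2 where g2: "gauge g2" "\<And>p. p tagged_division_of {a..b} \<Longrightarrow> g2 fine p \<Longrightarrow>
        norm ((\<Sum>(x,k) \<in> p. measure lborel k *\<^sub>R h0 x) - I) < e"
      using h0 \<open>0 < e\<close> unfolding box_real[symmetric] has_integral by metis
    obtain p where p: "p tagged_division_of {a..b}" "(\<lambda>x. ball x (d x) \<inter> g2 x) fine p"
      using fine_division_exists_real[OF gauge_Int[OF g1 g2(1)]] by blast
    then have fine: "(\<lambda>x. ball x (d x)) fine p" "g2 fine p"
      by (simp_all add: fine_Int)
    define P1 where "P1 = {xk \<in> p. fst xk \<notin> N}"
    define P2 where "P2 = {xk \<in> p. fst xk \<in> N}"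
    define D where "D = (\<lambda>k. F (Sup k) - F (Inf k))"
    note tp = tagged_division_ofD[OF p(1)]
    have finp: "finite p" "finite P1" "finite P2" using tp(1) by (auto simp: P1_def P2_def)
    have kI: "Inf k \<le> x \<and> x \<le> Sup k \<and> k = {Inf k..Sup k} \<and> a \<le> Inf k \<and> Sup k \<le> b"
      if xk: "(x, k) \<in> p" for x k
    proof -
      obtain u v where k: "k = cbox u v" using tp(4)[OF xk] by blast
      have "x \<in> k" "k \<subseteq> {a..b}" using tp(2,3)[OF xk] by auto
      with k show ?thesis by auto
    qed
    have "F b - F a = (\<Sum>(x,k) \<in> p. D k)"
      unfolding D_def using additive_tagged_division_1[OF \<open>a \<le> b\<close> p(1), of F] by simp
    also have "\<dots> = (\<Sum>(x,k) \<in> P1. D k) + (\<Sum>(x,k) \<in> P2. D k)"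
      unfolding P1_def P2_def by (subst sum.union_disjoint[symmetric]) (use finp in \<open>auto intro!: sum.cong\<close>)
    also have "(\<Sum>(x,k) \<in> P1. D k) \<le> (\<Sum>(x,k) \<in> P1. measure lborel k * (h0 x + e))"
    proof (rule sum_mono, clarify)
      fix x k assume "(x, k) \<in> P1"
      then have xk: "(x, k) \<in> p" "x \<notin> N" by (auto simp: P1_def)
      from kI[OF xk(1)] have k: "Inf k \<le> x" "x \<le> Sup k" "k = {Inf k..Sup k}" "a \<le> x" "x \<le> b" by auto
      have "k \<subseteq> ball x (d x)" using fine(1) xk(1) by (auto simp: fine_def)
      then have "D k \<le> (h0 x + e) * (Sup k - Inf k)"
        unfolding D_def using k xk by (intro d(3)) auto
      also have "Sup k - Inf k = measure lborel k"
        using k by (metis content_real order_trans)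
      finally show "D k \<le> measure lborel k * (h0 x + e)" by (simp add: mult.commute)
    qed
    also have "\<dots> = (\<Sum>(x,k) \<in> P1. measure lborel k * h0 x) + e * (\<Sum>(x,k) \<in> P1. measure lborel k)"
      by (simp add: sum_distrib_left sum.distrib[symmetric] split_def algebra_simps)
    also have "(\<Sum>(x,k) \<in> P1. measure lborel k * h0 x) = (\<Sum>(x,k) \<in> p. measure lborel k * h0 x)"
      using finp(1) by (intro sum.mono_neutral_left) (auto simp: P1_def h0_def)
    also have "(\<Sum>(x,k) \<in> p. measure lborel k * h0 x) \<le> I + e"
      using g2(2)[OF p(1) fine(2)] by (simp add: abs_less_iff)
    also have "e * (\<Sum>(x,k) \<in> P1. measure lborel k) \<le> e * (b - a)"
    proof -
      have "(\<Sum>(x,k) \<in> P1. measure lborel k) \<le> (\<Sum>(x,k) \<in> p. measure lborel k)"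
        using finp(1) by (intro sum_mono2) (auto simp: P1_def)
      also have "\<dots> = b - a"
        using additive_content_tagged_division[of p a b] p(1) \<open>a \<le> b\<close> by simp
      finally show ?thesis using \<open>0 < e\<close> by simp
    qed
    also have "(\<Sum>(x,k) \<in> P2. D k) \<le> e"
    proof -
      \<comment> \<open>Absolute continuity speaks of indexed families, so the cells tagged in
        \<open>N\<close> are enumerated. Their interiors are disjoint and lie in \<open>U\<close>,
        hence their lengths sum to less than \<delta>.\<close>
      obtain q where q: "bij_betw q {..<card P2} P2"
        using ex_bij_betw_nat_finite[OF finp(3)] by (auto simp: atLeast0LessThan)
      define u where "u = (\<lambda>i. Inf (snd (q i)))"
      define v where "v = (\<lambda>i. Sup (snd (q i)))"
      have qp: "q i \<in> p" "fst (q i) \<in> N" if "i < card P2" for i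
        using bij_betwE[OF q] that by (auto simp: P2_def)
      have uv: "u i \<le> v i" "a \<le> u i" "v i \<le> b" "snd (q i) = {u i..v i}" "{u i..v i} \<subseteq> U"
        if "i < card P2" for i
      proof -
        have "(fst (q i), snd (q i)) \<in> p" using qp[OF that] by simp
        note k = kI[OF this] and f = fine(1)[unfolded fine_def, rule_format, OF this]
        from k show "u i \<le> v i" "a \<le> u i" "v i \<le> b" "snd (q i) = {u i..v i}" by (auto simp: u_def v_def)
        with f d(2)[OF qp(2)[OF that]] show "{u i..v i} \<subseteq> U" by auto
      qed
      have dis: "disjoint_family_on (\<lambda>k. {u k<..<v k}) {..<card P2}"
        unfolding disjoint_family_on_def
      proof (intro ballI impI)
        fix i j assume ij: "i \<in> {..<card P2}" "j \<in> {..<card P2}" "i \<noteq> j"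
        then have "q i \<noteq> q j" using q by (auto simp: bij_betw_def inj_on_def)
        then have "interior (snd (q i)) \<inter> interior (snd (q j)) = {}"
          using tp(5)[of "fst (q i)" "snd (q i)" "fst (q j)" "snd (q j)"] qp ij by (simp add: prod_eq_iff) 
        then show "{u i<..<v i} \<inter> {u j<..<v j} = {}"
          using uv(4)[of i] uv(4)[of j] ij by simp
      qed
      have "ennreal (\<Sum>i<card P2. v i - u i) = (\<Sum>i<card P2. emeasure lborel {u i<..<v i})"
        using uv(1) by (subst sum_ennreal[symmetric]) auto
      also have "\<dots> = emeasure lborel (\<Union>i<card P2. {u i<..<v i})"
        using dis by (intro sum_emeasure) auto
      also have "\<dots> \<le> emeasure lborel U"
      proof (rule emeasure_mono)
        show "(\<Union>i<card P2. {u i<..<v i}) \<subseteq> U"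
          using uv(5) by (fastforce simp: subset_iff)
      qed (use U in simp)
      finally have len: "(\<Sum>i<card P2. v i - u i) < \<delta>"
        using Um \<open>\<delta> > 0\<close> by (meson ennreal_less_iff le_less_trans less_imp_le ennreal_leI linorder_not_less)
      have "(\<Sum>(x,k) \<in> P2. D k) = (\<Sum>i<card P2. F (v i) - F (u i))"
        using sum.reindex_bij_betw[OF q, of "\<lambda>(x,k). D k"] by (simp add: split_def D_def u_def v_def)
      also have "\<dots> \<le> (\<Sum>i<card P2. \<bar>F (v i) - F (u i)\<bar>)"
        by (rule sum_mono) simp
      also have "\<dots> < e"
        using uv ab dis len by (intro \<delta>[rule_format]) (auto intro: order_trans)
      finally show ?thesis by simp
    qed
    finally show ?thesis by (simp add: algebra_simps)
  qed
  then have *: "F b - F a \<le> I + e * (b - a + 2)" if "0 < e" for e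
    using that by blast
  show ?thesis
  proof (rule field_le_epsilon)
    fix e :: real assume "0 < e"
    then show "F b - F a \<le> I + e"
      using *[of "e / (b - a + 2)"] ab by simp
  qed
qed

section \<open>Convexity of the partition function\<close>

lemma torus_chamber_diff:
  assumes "\<alpha> \<in> torus_chamber n" "1 \<le> i" "i < j" "j \<le> n"
  shows "0 < \<alpha> j - \<alpha> i" "\<alpha> j - \<alpha> i < 2 * pi"
proof -
  have lt: "\<alpha> k < \<alpha> l" if "1 \<le> k" "k < l" "l \<le> n" for k l
    using assms(1) that by (auto simp: torus_chamber_def)
  have le: "\<alpha> k \<le> \<alpha> l" if "1 \<le> k" "k \<le> l" "l \<le> n" for k l
    using lt[of k l] that by (cases "k = l") auto
  show "0 < \<alpha> j - \<alpha> i" using lt[of i j] assms by simp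
  have "\<alpha> j \<le> \<alpha> n" "\<alpha> 1 \<le> \<alpha> i" using le assms by auto
  moreover have "\<alpha> n < \<alpha> 1 + 2 * pi" using assms(1) by (simp add: torus_chamber_def)
  ultimately show "\<alpha> j - \<alpha> i < 2 * pi" by simp
qed

lemma sum_off_diagonal:
  fixes h :: "nat \<Rightarrow> nat \<Rightarrow> 'a::comm_monoid_add"
  shows "(\<Sum>j=1..n. \<Sum>i\<in>{1..n}-{j}. h j i) = (\<Sum>j=1..n. \<Sum>i=1..<j. h j i + h i j)"
proof (induction n)
  case (Suc n)
  have "(\<Sum>j=1..n. \<Sum>i\<in>{1..Suc n}-{j}. h j i) = (\<Sum>j=1..n. h j (Suc n) + (\<Sum>i\<in>{1..n}-{j}. h j i))"
  proof (rule sum.cong[OF refl])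
    fix j assume "j \<in> {1..n}"
    then have "{1..Suc n} - {j} = insert (Suc n) ({1..n} - {j})" by auto
    then show "(\<Sum>i\<in>{1..Suc n}-{j}. h j i) = h j (Suc n) + (\<Sum>i\<in>{1..n}-{j}. h j i)" by simp
  qed
  moreover have "{1..Suc n} - {Suc n} = {1..n}" by auto
  ultimately show ?case
    using Suc by (simp add: sum.distrib atLeastLessThanSuc_atLeastAtMost ac_simps)
qed simp

section \<open>Gradient and tangent inequality\<close>

text \<open>The gradient of \<open>partition_U\<close>; since cot is odd, one formula covers i < j
  and i > j. The drift inside the energy is \<open>- 2 * partition_grad\<close>, so the energy
  density is the squared norm of \<theta>' plus twice the gradient.\<close>

definition partition_grad :: "nat \<Rightarrow> (nat \<Rightarrow> real) \<Rightarrow> nat \<Rightarrow> real" where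
  "partition_grad n \<alpha> j = - (\<Sum>i\<in>{1..n} - {j}. cot ((\<alpha> j - \<alpha> i) / 2))"

text \<open>The ordered pairs (j, i) and (i, j) are combined, using that cot is odd. In this form
  the directional derivative sees only differences of angles, as \<open>partition_U\<close>
  does.\<close>

lemma partition_grad_inner:
  "(\<Sum>j=1..n. partition_grad n \<alpha> j * d j) =
    (\<Sum>j=1..n. \<Sum>i=1..<j. - cot ((\<alpha> j - \<alpha> i) / 2) * (d j - d i))"
proof -
  have "(\<Sum>j=1..n. partition_grad n \<alpha> j * d j) = (\<Sum>j=1..n. \<Sum>i\<in>{1..n}-{j}. - cot ((\<alpha> j - \<alpha> i) / 2) * d j)"
    by (simp add: partition_grad_def sum_distrib_right sum_negf)
  also have "\<dots> = (\<Sum>j=1..n. \<Sum>i=1..<j. - cot ((\<alpha> j - \<alpha> i) / 2) * d j + - cot ((\<alpha> i - \<alpha> j) / 2) * d i)"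
    by (rule sum_off_diagonal)
  also have "\<dots> = (\<Sum>j=1..n. \<Sum>i=1..<j. - cot ((\<alpha> j - \<alpha> i) / 2) * (d j - d i))"
  proof (intro sum.cong refl)
    fix i j
    have "cot ((\<alpha> i - \<alpha> j) / 2) = - cot ((\<alpha> j - \<alpha> i) / 2)"
      by (metis cot_minus minus_diff_eq minus_divide_left)
    then show "- cot ((\<alpha> j - \<alpha> i) / 2) * d j + - cot ((\<alpha> i - \<alpha> j) / 2) * d i
      = - cot ((\<alpha> j - \<alpha> i) / 2) * (d j - d i)" by (simp add: algebra_simps)
  qed
  finally show ?thesis .
qed

text \<open>Infinitesimal rotation invariance: a constant direction has no pairwise
  differences.\<close>

lemma sum_partition_grad: "(\<Sum>j=1..n. partition_grad n \<alpha> j) = 0"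
  using partition_grad_inner[of n \<alpha> "\<lambda>_. 1"] by simp

lemma DERIV_ln_sin_half:
  assumes "0 < x" "x < 2 * pi"
  shows "((\<lambda>x. - 2 * ln (sin (x / 2))) has_real_derivative - cot (x / 2)) (at x)"
proof -
  have "sin (x / 2) > 0" using assms by (intro sin_gt_zero) auto
  then show ?thesis
    by (auto intro!: derivative_eq_intros simp: cot_def)
qed

text \<open>Convexity, from the second derivative 1 / (2 sin^2 (x / 2)) > 0, in the form of a graph
  lying above its tangents.\<close>

lemma ln_sin_half_tangent:
  assumes "0 < x" "x < 2 * pi" "0 < y" "y < 2 * pi"
  shows "- cot (x / 2) * (y - x) \<le> - 2 * ln (sin (y / 2)) - (- 2 * ln (sin (x / 2)))"
proof (rule f''_imp_f'[where C="{0<..<2*pi}" and f''="\<lambda>x. inverse ((sin (x / 2))\<^sup>2) / 2"])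
  fix x :: real assume x: "x \<in> {0<..<2*pi}"
  then show "((\<lambda>x. - 2 * ln (sin (x / 2))) has_real_derivative - cot (x / 2)) (at x)"
    by (intro DERIV_ln_sin_half) auto
  have "sin (x / 2) > 0" using x by (intro sin_gt_zero) auto
  then have "((\<lambda>x. cot (x / 2)) has_real_derivative - inverse ((sin (x / 2))\<^sup>2) * (1 / 2)) (at x)"
    by (intro DERIV_chain2[OF DERIV_cot]) (auto intro!: derivative_eq_intros)
  from DERIV_minus[OF this]
  show "((\<lambda>x. - cot (x / 2)) has_real_derivative inverse ((sin (x / 2))\<^sup>2) / 2) (at x)"
    by simp
qed (use assms in auto)

lemma partition_U_tangent:
  assumes "\<alpha> \<in> torus_chamber n" "\<beta> \<in> torus_chamber n"
  shows "(\<Sum>j=1..n. partition_grad n \<alpha> j * (\<beta> j - \<alpha> j)) \<le> partition_U n \<beta> - partition_U n \<alpha>"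
proof -
  have "(\<Sum>j=1..n. partition_grad n \<alpha> j * (\<beta> j - \<alpha> j)) =
      (\<Sum>j=1..n. \<Sum>i=1..<j. - cot ((\<alpha> j - \<alpha> i) / 2) * ((\<beta> j - \<beta> i) - (\<alpha> j - \<alpha> i)))"
    unfolding partition_grad_inner by (simp add: algebra_simps)
  also have "\<dots> \<le> (\<Sum>j=1..n. \<Sum>i=1..<j. - 2 * ln (sin ((\<beta> j - \<beta> i) / 2)) - (- 2 * ln (sin ((\<alpha> j - \<alpha> i) / 2))))"
    using torus_chamber_diff assms by (intro sum_mono ln_sin_half_tangent) auto
  also have "\<dots> = partition_U n \<beta> - partition_U n \<alpha>"
    unfolding partition_U_def by (simp only: sum_subtractf sum_distrib_left)
  finally show ?thesis .
qed

section \<open>The equispaced minimum and the distance to it\<close>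

definition equispaced :: "nat \<Rightarrow> nat \<Rightarrow> real" where
  "equispaced n j = 2 * pi * real j / real n"

lemma equispaced_chamber:
  assumes "n \<ge> 1"
  shows "equispaced n \<in> torus_chamber n"
  using assms by (auto simp: torus_chamber_def equispaced_def divide_strict_right_mono)

lemma cot_add_pi: "cot (x + pi) = cot (x::real)"
  by (simp add: cot_def)

text \<open>By \<pi>-periodicity of cot the sum runs over the values cot (\<pi> m / n) for all
  nonzero residues m modulo n, and the reflection of m to n - m changes the sign of each
  value.\<close>

lemma partition_grad_equispaced:
  assumes "j \<in> {1..n}"
  shows "partition_grad n (equispaced n) j = 0"
proof -
  define c where "c = (\<lambda>m::nat. cot (pi * real m / real n))"
  have n: "n > 0" using assms by auto
  have c_flip: "c (n - m) = - c m" if "m < n" for m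
  proof -
    have "pi * real (n - m) / real n = - (pi * real m / real n) + pi"
      using n that by (simp add: field_simps of_nat_diff)
    then show ?thesis unfolding c_def by (simp only: cot_add_pi cot_minus)
  qed
  have zero: "(\<Sum>m=1..<n. c m) = 0"
  proof -
    have "(\<Sum>m=1..<n. c m) = (\<Sum>m=1..<n. c (n - m))"
      by (rule sum.reindex_bij_witness[of _ "\<lambda>m. n - m" "\<lambda>m. n - m"]) auto
    also have "\<dots> = - (\<Sum>m=1..<n. c m)"
      by (simp add: c_flip sum_negf[symmetric] cong: sum.cong_simp)
    finally show ?thesis by simp
  qed
  have split: "{1..n} - {j} = {1..<j} \<union> {j<..n}" using assms by auto
  have "(\<Sum>i\<in>{1..n} - {j}. cot ((equispaced n j - equispaced n i) / 2))
     = (\<Sum>i=1..<j. cot ((equispaced n j - equispaced n i) / 2)) + (\<Sum>i\<in>{j<..n}. cot ((equispaced n j - equispaced n i) / 2))"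
    unfolding split by (rule sum.union_disjoint) auto
  also have "(\<Sum>i=1..<j. cot ((equispaced n j - equispaced n i) / 2)) = (\<Sum>m=1..<j. c m)"
  proof (rule sum.reindex_bij_witness[of _ "\<lambda>m. j - m" "\<lambda>m. j - m"])
    fix i assume "i \<in> {1..<j}"
    then have "(equispaced n j - equispaced n i) / 2 = pi * real (j - i) / real n"
      using n by (simp add: equispaced_def field_simps of_nat_diff)
    then show "c (j - i) = cot ((equispaced n j - equispaced n i) / 2)" by (simp add: c_def)
  qed auto
  \<comment> \<open>For i > j the difference j - i is negative; adding one period moves it to n + j
    - i, and these indices fill \<open>{j..<n}\<close>, exactly what the terms with i < j leave
    out.\<close>
  also have "(\<Sum>i\<in>{j<..n}. cot ((equispaced n j - equispaced n i) / 2)) = (\<Sum>m=j..<n. c m)"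
  proof (rule sum.reindex_bij_witness[of _ "\<lambda>m. n + j - m" "\<lambda>i. n + j - i"])
    fix i assume i: "i \<in> {j<..n}"
    then have "pi * real (n + j - i) / real n = (equispaced n j - equispaced n i) / 2 + pi"
      using n by (simp add: equispaced_def field_simps of_nat_diff)
    then show "c (n + j - i) = cot ((equispaced n j - equispaced n i) / 2)"
      by (simp only: c_def cot_add_pi)
  qed (use assms in auto)
  also have "(\<Sum>m=1..<j. c m) + (\<Sum>m=j..<n. c m) = (\<Sum>m=1..<n. c m)"
    using assms by (intro sum.atLeastLessThan_concat) auto
  finally show ?thesis using zero by (simp add: partition_grad_def)
qed

lemma partition_U_equispaced_le:
  assumes "n \<ge> 1" "\<alpha> \<in> torus_chamber n"
  shows "partition_U n (equispaced n) \<le> partition_U n \<alpha>"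
  using partition_U_tangent[OF equispaced_chamber[OF assms(1)] assms(2)]
  by (simp add: partition_grad_equispaced)

text \<open>The tangent at \<alpha> is evaluated at the equispaced point. Because the gradient has
  zero sum, the shift \<open>s\<close> aligning the first angles may be subtracted for free; then
  \<alpha> j - \<alpha> 1 and \<beta> j - \<beta> 1 both lie between 0 and 2 \<pi>, which bounds
  each coordinate of the displacement.\<close>

lemma partition_U_gap_le_grad:
  assumes "n \<ge> 1" "\<alpha> \<in> torus_chamber n"
  shows "partition_U n \<alpha> - partition_U n (equispaced n) \<le> 2 * pi * (\<Sum>j=1..n. \<bar>partition_grad n \<alpha> j\<bar>)"
proof -
  define \<beta> where "\<beta> = equispaced n"
  have \<beta>: "\<beta> \<in> torus_chamber n" using equispaced_chamber[OF assms(1)] by (simp add: \<beta>_def)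
  define s where "s = \<alpha> 1 - \<beta> 1"
  have "partition_U n \<alpha> - partition_U n \<beta> \<le> - (\<Sum>j=1..n. partition_grad n \<alpha> j * (\<beta> j - \<alpha> j))"
    using partition_U_tangent[OF assms(2) \<beta>] by simp
  also have "\<dots> = (\<Sum>j=1..n. partition_grad n \<alpha> j * (\<alpha> j - \<beta> j)) - (\<Sum>j=1..n. partition_grad n \<alpha> j) * s"
    unfolding sum_partition_grad by (simp add: sum_negf[symmetric] algebra_simps)
  also have "\<dots> = (\<Sum>j=1..n. partition_grad n \<alpha> j * (\<alpha> j - \<beta> j - s))"
    by (simp only: sum_distrib_right sum_subtractf right_diff_distrib)
  also have "\<dots> \<le> (\<Sum>j=1..n. \<bar>partition_grad n \<alpha> j\<bar> * (2 * pi))"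
  proof (rule sum_mono)
    fix j assume j: "j \<in> {1..n}"
    have "0 \<le> \<alpha> j - \<alpha> 1 \<and> \<alpha> j - \<alpha> 1 \<le> 2 * pi" "0 \<le> \<beta> j - \<beta> 1 \<and> \<beta> j - \<beta> 1 \<le> 2 * pi"
      using torus_chamber_diff[OF assms(2), of 1 j] torus_chamber_diff[OF \<beta>, of 1 j] j
      by (cases "j = 1"; auto)+
    then have "\<bar>\<alpha> j - \<beta> j - s\<bar> \<le> 2 * pi" unfolding s_def by linarith
    then have "\<bar>partition_grad n \<alpha> j * (\<alpha> j - \<beta> j - s)\<bar> \<le> \<bar>partition_grad n \<alpha> j\<bar> * (2 * pi)"
      unfolding abs_mult by (rule mult_left_mono) simp
    then show "partition_grad n \<alpha> j * (\<alpha> j - \<beta> j - s) \<le> \<bar>partition_grad n \<alpha> j\<bar> * (2 * pi)" by linarith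
  qed
  also have "\<dots> = 2 * pi * (\<Sum>j=1..n. \<bar>partition_grad n \<alpha> j\<bar>)"
    by (simp add: sum_distrib_left mult.commute)
  finally show ?thesis by (simp add: \<beta>_def)
qed

lemma INF_partition_U:
  assumes "n \<ge> 1"
  shows "(INF \<alpha>\<in>torus_chamber n. ereal (partition_U n \<alpha>)) = ereal (partition_U n (equispaced n))"
  using partition_U_equispaced_le[OF assms] equispaced_chamber[OF assms]
  by (intro antisym INF_lower INF_greatest) auto

lemma partition_U_equispaced:
  "partition_U n (equispaced n) = - 2 * (\<Sum>j=1..n. \<Sum>i=1..<j. ln (sin (pi * (real j - real i) / real n)))"
proof -
  have "(equispaced n j - equispaced n i) / 2 = pi * (real j - real i) / real n" for i j
    by (cases "n = 0") (simp_all add: equispaced_def field_simps)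
  then show ?thesis by (simp add: partition_U_def)
qed

section \<open>Uniqueness of the driving points\<close>

text \<open>The Schwarz lemma applied to g after the inverse of f, and to f after the inverse of g,
  shows that f and g have equal modulus everywhere. The equality case makes the first composition a
  rotation, and its derivative at 0 is a quotient of positive reals, so the rotation is
  trivial.\<close>

lemma normalized_conformal_map_unique:
  assumes "open D" "normalized_conformal_map D f" "normalized_conformal_map D g" "z \<in> D"
  shows "g z = f z"
proof -
  have f: "0 \<in> D" "f holomorphic_on D" "inj_on f D" "f ` D = ball 0 1" "f 0 = 0"
    using assms(2) by (auto simp: normalized_conformal_map_def bij_betw_def)
  have g: "g holomorphic_on D" "inj_on g D" "g ` D = ball 0 1" "g 0 = 0"
    using assms(3) by (auto simp: normalized_conformal_map_def bij_betw_def)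
  obtain a b where ab: "a > 0" "deriv f 0 = complex_of_real a" "b > 0" "deriv g 0 = complex_of_real b"
    using assms(2,3) by (auto simp: normalized_conformal_map_def)
  have ex: "\<exists>k. k holomorphic_on (h ` D) \<and> (\<forall>z\<in>D. deriv h z * deriv k (h z) = 1 \<and> k (h z) = z)"
    if "h holomorphic_on D" "inj_on h D" for h
    by (rule holomorphic_has_inverse[OF that(1) \<open>open D\<close> that(2)]) auto
  obtain f' where f': "f' holomorphic_on (f ` D)" "\<And>z. z \<in> D \<Longrightarrow> deriv f z * deriv f' (f z) = 1"
    "\<And>z. z \<in> D \<Longrightarrow> f' (f z) = z"
    using ex[OF f(2,3)] by blast
  obtain g' where g': "g' holomorphic_on (g ` D)" "\<And>z. z \<in> D \<Longrightarrow> g' (g z) = z"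
    using ex[OF g(1,2)] by blast
  have f'D: "f' w \<in> D" "f (f' w) = w" if "w \<in> ball 0 1" for w
    using that f'(3) f(4)[symmetric] by auto
  have g'D: "g' w \<in> D" "g (g' w) = w" if "w \<in> ball 0 1" for w
    using that g'(2) g(3)[symmetric] by auto
  have hol1: "(g \<circ> f') holomorphic_on ball 0 1"
    using f'(1) f(4) g(1) f'D by (intro holomorphic_on_compose_gen[where t=D]) auto
  have hol2: "(f \<circ> g') holomorphic_on ball 0 1"
    using g'(1) g(3) f(2) g'D by (intro holomorphic_on_compose_gen[where t=D]) auto
  have im1: "norm ((g \<circ> f') w) < 1" if "norm w < 1" for w
  proof -
    have "g (f' w) \<in> g ` D" using f'D(1)[of w] that by simp
    then show ?thesis unfolding g(3) by simp
  qed
  have im2: "norm ((f \<circ> g') w) < 1" if "norm w < 1" for w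
  proof -
    have "f (g' w) \<in> f ` D" using g'D(1)[of w] that by simp
    then show ?thesis unfolding f(4) by simp
  qed
  have f'0: "f' 0 = 0" and g'0: "g' 0 = 0"
    using f'(3)[OF f(1)] g'(2)[OF f(1)] f(5) g(4) by simp_all
  have c0: "(g \<circ> f') 0 = 0" "(f \<circ> g') 0 = 0"
    using f'0 g'0 f(5) g(4) by simp_all
  have le1: "norm (g y) \<le> norm (f y)" if "y \<in> D" for y
  proof -
    have "norm (f y) < 1" using that f(4) by auto
    from Schwarz_Lemma(1)[OF hol1 c0(1) im1 this] show ?thesis
      using f'(3)[OF that] f'0 g(4) by simp
  qed
  have le2: "norm (f y) \<le> norm (g y)" if "y \<in> D" for y
  proof -
    have "norm (g y) < 1" using that g(3) by auto
    from Schwarz_Lemma(1)[OF hol2 c0(2) im2 this] show ?thesis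
      using g'(2)[OF that] g'0 f(5) by simp
  qed
  have half: "(1/2::complex) \<in> ball 0 1" by simp
  \<comment> \<open>Any nonzero point of the disk would do as a witness for the equality
    case.\<close>
  have "norm ((g \<circ> f') (1/2)) = norm (1/2 :: complex)"
    using le1[OF f'D(1)[OF half]] le2[OF f'D(1)[OF half]] f'D(2)[OF half] by simp
  then have "\<exists>w. norm w < 1 \<and> w \<noteq> 0 \<and> norm ((g \<circ> f') w) = norm w"
    by (intro exI[of _ "1/2"]) simp
  then have "\<exists>\<alpha>. (\<forall>w. norm w < 1 \<longrightarrow> (g \<circ> f') w = \<alpha> * w) \<and> norm \<alpha> = 1"
    using Schwarz_Lemma(3)[OF hol1 c0(1) im1, of 0] by simp
  then obtain \<alpha> where \<alpha>: "\<And>w. norm w < 1 \<Longrightarrow> (g \<circ> f') w = \<alpha> * w" "norm \<alpha> = 1"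
    by blast
  have "deriv (g \<circ> f') 0 = deriv g 0 * deriv f' 0"
  proof -
    have "f' field_differentiable at 0"
      using f'(1) f(4) by (intro holomorphic_on_imp_differentiable_at[of _ "ball 0 1"]) auto
    moreover have "g field_differentiable at (f' 0)"
      using g(1) \<open>open D\<close> f(1) f'0 by (intro holomorphic_on_imp_differentiable_at[of _ D]) auto
    ultimately show ?thesis using f'0 by (simp add: deriv_chain)
  qed
  moreover have "deriv (g \<circ> f') 0 = \<alpha>"
  proof -
    have "((\<lambda>w. \<alpha> * w) has_field_derivative \<alpha>) (at 0)"
      by (auto intro!: derivative_eq_intros)
    then have "((g \<circ> f') has_field_derivative \<alpha>) (at 0)"
      by (rule has_field_derivative_transform_within_open[of _ _ _ "ball 0 1"]) (use \<alpha>(1) in auto)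
    then show ?thesis by (rule DERIV_imp_deriv)
  qed
  moreover have "deriv f' 0 = complex_of_real (1 / a)"
    using f'(2)[OF f(1)] ab f(5) by (simp add: field_simps)
  ultimately have "\<alpha> = complex_of_real (b / a)" using ab by simp
  then have "\<alpha> = 1" using \<alpha>(2) ab by (simp add: norm_divide)
  moreover have "norm (f z) < 1" using assms(4) f(4) by auto
  ultimately show ?thesis using \<alpha>(1)[of "f z"] f'(3)[OF assms(4)] by simp
qed

lemma open_slit_disk:
  assumes "\<And>j. j \<in> {1..n} \<Longrightarrow> continuous_on {0..} (\<gamma> j)"
  shows "open (slit_disk n \<gamma> t)"
proof -
  have "closed (\<gamma> j ` {0..t})" if "j \<in> {1..n}" for j
    using assms[OF that] by (intro compact_imp_closed compact_continuous_image) (auto elim: continuous_on_subset)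
  then show ?thesis
    unfolding slit_disk_def by (intro open_Diff closed_UN) auto
qed

lemma slit_disk_antimono: "s \<le> t \<Longrightarrow> slit_disk n \<gamma> t \<subseteq> slit_disk n \<gamma> s"
  unfolding slit_disk_def by fastforce

text \<open>Every \<open>w\<close> in the disk is g_t(z) for some z outside the curves up to time t.
  The slit disks shrink, so z lies in all earlier ones and both Loewner flows agree along z on
  [0, t]. Their one-sided derivatives at t > 0 then coincide, and w \<noteq> 0 cancels the common
  factor.\<close>

lemma multiradial_driving_field_unique:
  assumes "\<And>j. j \<in> {1..n} \<Longrightarrow> continuous_on {0..} (\<gamma> j)"
    and "multiradial_driving n \<gamma> \<theta>" "multiradial_driving n \<gamma> \<phi>" "0 < t" "0 < norm w" "norm w < 1"
  shows "(\<Sum>j=1..n. (cis (\<theta> t j) + w) / (cis (\<theta> t j) - w)) = (\<Sum>j=1..n. (cis (\<phi> t j) + w) / (cis (\<phi> t j) - w))"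
proof -
  obtain g where g: "\<And>t. 0 \<le> t \<Longrightarrow> normalized_conformal_map (slit_disk n \<gamma> t) (g t)"
    "\<And>t z. 0 \<le> t \<Longrightarrow> z \<in> slit_disk n \<gamma> t \<Longrightarrow> ((\<lambda>s. g s z) has_vector_derivative
              g t z * (\<Sum>j=1..n. (cis (\<theta> t j) + g t z) / (cis (\<theta> t j) - g t z))) (at t within {0..})"
    using assms(2) unfolding multiradial_driving_def by blast
  obtain h where h: "\<And>t. 0 \<le> t \<Longrightarrow> normalized_conformal_map (slit_disk n \<gamma> t) (h t)"
    "\<And>t z. 0 \<le> t \<Longrightarrow> z \<in> slit_disk n \<gamma> t \<Longrightarrow> ((\<lambda>s. h s z) has_vector_derivative
              h t z * (\<Sum>j=1..n. (cis (\<phi> t j) + h t z) / (cis (\<phi> t j) - h t z))) (at t within {0..})"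
    using assms(3) unfolding multiradial_driving_def by blast
  have "w \<in> g t ` slit_disk n \<gamma> t"
    using g(1)[of t] assms(4,6) by (auto simp: normalized_conformal_map_def bij_betw_def)
  then obtain z where z: "z \<in> slit_disk n \<gamma> t" "g t z = w" by blast
  have eq: "h s z = g s z" if "s \<in> {0..t}" for s
    using that z(1) slit_disk_antimono[of s t n \<gamma>] g(1)[of s] h(1)[of s] open_slit_disk[OF assms(1)]
    by (intro normalized_conformal_map_unique[of "slit_disk n \<gamma> s"]) auto
  have d1: "((\<lambda>s. g s z) has_vector_derivative
      w * (\<Sum>j=1..n. (cis (\<theta> t j) + w) / (cis (\<theta> t j) - w))) (at t within cbox 0 t)"
    using g(2)[of t z] z \<open>0 < t\<close> by (auto elim!: has_vector_derivative_within_subset)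
  have "((\<lambda>s. h s z) has_vector_derivative
      w * (\<Sum>j=1..n. (cis (\<phi> t j) + w) / (cis (\<phi> t j) - w))) (at t within cbox 0 t)"
    using h(2)[of t z] z \<open>0 < t\<close> eq[of t] by (auto elim!: has_vector_derivative_within_subset)
  then have d2: "((\<lambda>s. g s z) has_vector_derivative
      w * (\<Sum>j=1..n. (cis (\<phi> t j) + w) / (cis (\<phi> t j) - w))) (at t within cbox 0 t)"
    by (rule has_vector_derivative_transform[rotated 2]) (use eq \<open>0 < t\<close> in auto)
  have "w * (\<Sum>j=1..n. (cis (\<theta> t j) + w) / (cis (\<theta> t j) - w)) = w * (\<Sum>j=1..n. (cis (\<phi> t j) + w) / (cis (\<phi> t j) - w))"
    using \<open>0 < t\<close> by (intro vector_derivative_unique_within_closed_interval[OF _ _ d1 d2]) auto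
  then show ?thesis using assms(5) by auto
qed

text \<open>The right-hand side of the Loewner equation blows up along the ray towards a driving point.\<close>

lemma pole_in_image:
  fixes x y :: "nat \<Rightarrow> complex"
  assumes eq: "\<And>w. 0 < norm w \<Longrightarrow> norm w < 1 \<Longrightarrow>
      (\<Sum>j=1..n. (x j + w) / (x j - w)) = (\<Sum>j=1..n. (y j + w) / (y j - w))"
    and "inj_on x {1..n}" "k \<in> {1..n}" "norm (x k) = 1"
  shows "x k \<in> y ` {1..n}"
proof (rule ccontr)
  assume notin: "x k \<notin> y ` {1..n}"
  \<comment> \<open>Along the ray r * x k the factor 1 - r turns the simple pole at
    \<open>x k\<close> into the finite limit 2 and sends every term with another base point to
    0.\<close>
  define T where "T = (\<lambda>(u::complex) (r::real). of_real (1 - r) * ((u + of_real r * x k) / (u - of_real r * x k)))"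
  have T0: "(T u \<longlongrightarrow> 0) (at_left 1)" if "u \<noteq> x k" for u
  proof -
    have "(T u \<longlongrightarrow> of_real (1 - 1) * ((u + of_real 1 * x k) / (u - of_real 1 * x k))) (at_left 1)"
      unfolding T_def using that by (intro tendsto_intros) auto
    then show ?thesis by simp
  qed
  have ev: "\<forall>\<^sub>F r in at_left (1::real). 0 < r \<and> r < 1"
    using eventually_at_left[of "0::real" 1] by (auto intro!: exI[of _ 0])
  have xk: "x k \<noteq> 0" using assms(4) by auto
  have T2: "(T (x k) \<longlongrightarrow> 2) (at_left 1)"
  proof -
    have "((\<lambda>r. 1 + of_real r) \<longlongrightarrow> (1 + of_real 1 :: complex)) (at_left (1::real))"
      by (intro tendsto_intros)
    moreover have "\<forall>\<^sub>F r in at_left 1. 1 + of_real r = T (x k) r"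
      using ev
    proof eventually_elim
      case (elim r)
      have "x k + of_real r * x k = (1 + of_real r) * x k" "x k - of_real r * x k = of_real (1 - r) * x k"
        by (simp_all add: algebra_simps)
      then have "T (x k) r = of_real (1 - r) * (((1 + of_real r) * x k) / (of_real (1 - r) * x k))"
        by (simp add: T_def)
      also have "\<dots> = 1 + of_real r" using elim xk by (simp add: field_simps)
      finally show ?case by simp
    qed
    ultimately show ?thesis by (simp add: filterlim_cong[OF refl refl])
  qed
  \<comment> \<open>Injectivity leaves exactly one term with limit 2.\<close>
  have "((\<lambda>r. \<Sum>j=1..n. T (x j) r) \<longlongrightarrow> (\<Sum>j=1..n. if j = k then 2 else 0)) (at_left 1)"
  proof (rule tendsto_sum)
    fix j assume "j \<in> {1..n}"
    then have "j \<noteq> k \<Longrightarrow> x j \<noteq> x k"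
      using assms(2,3) unfolding inj_on_def by blast
    then show "(T (x j) \<longlongrightarrow> (if j = k then 2 else 0)) (at_left 1)"
      using T2 T0[of "x j"] by auto
  qed
  then have l1: "((\<lambda>r. \<Sum>j=1..n. T (x j) r) \<longlongrightarrow> 2) (at_left 1)"
    using assms(3) by simp
  have "((\<lambda>r. \<Sum>j=1..n. T (y j) r) \<longlongrightarrow> (\<Sum>j=1..n. 0)) (at_left 1)"
    by (intro tendsto_sum T0) (metis notin image_eqI)
  moreover have "\<forall>\<^sub>F r in at_left 1. (\<Sum>j=1..n. T (y j) r) = (\<Sum>j=1..n. T (x j) r)"
    using ev
  proof eventually_elim
    case (elim r)
    have "0 < norm (of_real r * x k)" "norm (of_real r * x k) < 1"
      using elim assms(4) by (auto simp: norm_mult)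
    from eq[OF this] show ?case
      unfolding T_def sum_distrib_left[symmetric] by simp
  qed
  ultimately have "((\<lambda>r. \<Sum>j=1..n. T (x j) r) \<longlongrightarrow> 0) (at_left 1)"
    by (simp add: tendsto_cong)
  with l1 show False
    using tendsto_unique[OF trivial_limit_at_left_real] by fastforce
qed

section \<open>The partition function as a function of the point set\<close>

lemma norm_cis_diff: "norm (cis a - cis b) = 2 * \<bar>sin ((a - b) / 2)\<bar>"
proof -
  have "sin ((b - a) / 2) = - sin ((a - b) / 2)"
    by (metis minus_diff_eq minus_divide_left sin_minus)
  then have "cis a - cis b = cis ((a + b) / 2) * (\<i> * of_real (2 * sin ((a - b) / 2)))"
    by (simp add: complex_eq_iff cos_diff_cos sin_diff_sin)
  then show ?thesis by (simp add: norm_mult del: of_real_mult)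
qed

lemma torus_chamber_sin_pos:
  assumes "\<alpha> \<in> torus_chamber n" "i \<in> {1..n}" "j \<in> {1..n}" "i < j"
  shows "0 < sin ((\<alpha> j - \<alpha> i) / 2)"
  using torus_chamber_diff[OF assms(1), of i j] assms by (intro sin_gt_zero) auto

lemma inj_on_cis_torus_chamber:
  assumes "\<alpha> \<in> torus_chamber n"
  shows "inj_on (\<lambda>j. cis (\<alpha> j)) {1..n}"
proof -
  have "cis (\<alpha> i) \<noteq> cis (\<alpha> j)" if "i \<in> {1..n}" "j \<in> {1..n}" "i < j" for i j
    using torus_chamber_sin_pos[OF assms that] norm_cis_diff[of "\<alpha> j" "\<alpha> i"] by auto
  then show ?thesis by (auto intro!: linorder_inj_onI)
qed

text \<open>Two lifts may start their cyclic labelling at different points, so the labels have to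
  go. Half a chord is the sine of half the angle, and the sum over ordered pairs counts each pair
  twice, which accounts for the factor 2 in \<open>partition_U\<close>.\<close>

lemma partition_U_eq_sum_points:
  assumes "\<alpha> \<in> torus_chamber n" and X: "X = (\<lambda>j. cis (\<alpha> j)) ` {1..n}"
  shows "partition_U n \<alpha> = - (\<Sum>x\<in>X. \<Sum>y\<in>X - {x}. ln (norm (x - y) / 2))"
proof -
  note inj = inj_on_cis_torus_chamber[OF assms(1)]
  have "(\<Sum>x\<in>X. \<Sum>y\<in>X - {x}. ln (norm (x - y) / 2))
      = (\<Sum>j=1..n. \<Sum>y\<in>X - {cis (\<alpha> j)}. ln (norm (cis (\<alpha> j) - y) / 2))"
    unfolding X by (subst sum.reindex[OF inj]) simp
  also have "\<dots> = (\<Sum>j=1..n. \<Sum>i\<in>{1..n} - {j}. ln (norm (cis (\<alpha> j) - cis (\<alpha> i)) / 2))"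
  proof (rule sum.cong[OF refl])
    fix j assume j: "j \<in> {1..n}"
    have "X - {cis (\<alpha> j)} = (\<lambda>j. cis (\<alpha> j)) ` ({1..n} - {j})"
      unfolding X using inj_on_image_set_diff[OF inj, of "{1..n}" "{j}"] j by simp
    then show "(\<Sum>y\<in>X - {cis (\<alpha> j)}. ln (norm (cis (\<alpha> j) - y) / 2))
        = (\<Sum>i\<in>{1..n} - {j}. ln (norm (cis (\<alpha> j) - cis (\<alpha> i)) / 2))"
      using inj by (simp add: sum.reindex inj_on_diff)
  qed
  also have "\<dots> = (\<Sum>j=1..n. \<Sum>i=1..<j. ln (norm (cis (\<alpha> j) - cis (\<alpha> i)) / 2) + ln (norm (cis (\<alpha> i) - cis (\<alpha> j)) / 2))"
    by (rule sum_off_diagonal)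
  also have "\<dots> = (\<Sum>j=1..n. \<Sum>i=1..<j. 2 * ln (sin ((\<alpha> j - \<alpha> i) / 2)))"
  proof (intro sum.cong refl)
    fix j i assume "j \<in> {1..n}" "i \<in> {1..<j}"
    then have "0 < sin ((\<alpha> j - \<alpha> i) / 2)"
      using assms(1) by (intro torus_chamber_sin_pos) auto
    then show "ln (norm (cis (\<alpha> j) - cis (\<alpha> i)) / 2) + ln (norm (cis (\<alpha> i) - cis (\<alpha> j)) / 2)
      = 2 * ln (sin ((\<alpha> j - \<alpha> i) / 2))"
      using norm_minus_commute[of "cis (\<alpha> i)" "cis (\<alpha> j)"] by (simp add: norm_cis_diff)
  qed
  finally show ?thesis by (simp add: partition_U_def sum_distrib_left sum_negf)
qed

theorem multiradial_driving_partition_U_unique: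
  assumes "\<And>j. j \<in> {1..n} \<Longrightarrow> continuous_on {0..} (\<gamma> j)"
    and "multiradial_driving n \<gamma> \<theta>" "multiradial_driving n \<gamma> \<phi>" "0 < t"
  shows "partition_U n (\<theta> t) = partition_U n (\<phi> t)"
proof -
  have ch: "\<theta> t \<in> torus_chamber n" "\<phi> t \<in> torus_chamber n"
    using assms(2-4) by (auto simp: multiradial_driving_def)
  have "(\<lambda>j. cis (\<theta> t j)) ` {1..n} = (\<lambda>j. cis (\<phi> t j)) ` {1..n}"
    using pole_in_image[OF multiradial_driving_field_unique[OF assms] inj_on_cis_torus_chamber[OF ch(1)]]
      pole_in_image[OF multiradial_driving_field_unique[OF assms(1,3,2,4)] inj_on_cis_torus_chamber[OF ch(2)]]
    by auto
  then show ?thesis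
    using partition_U_eq_sum_points[OF ch(1) refl] partition_U_eq_sum_points[OF ch(2) refl] by simp
qed

section \<open>Dissipation along finite-energy drivings\<close>

lemma abs_continuous_dominated:
  assumes f: "abs_continuous_on_interval a b f" and g: "abs_continuous_on_interval a b g"
    and dom: "\<And>x y. x \<in> {a..b} \<Longrightarrow> y \<in> {a..b} \<Longrightarrow> \<bar>F y - F x\<bar> \<le> C * (\<bar>f y - f x\<bar> + \<bar>g y - g x\<bar>)"
  shows "abs_continuous_on_interval a b F"
  unfolding abs_continuous_on_interval_def
proof (intro allI impI)
  fix e :: real assume "e > 0"
  \<comment> \<open>\<open>C\<close> may be zero or negative; a positive bound is needed to divide
    by.\<close>
  define B where "B = \<bar>C\<bar> + 1"
  have B: "B > 0" "C \<le> B" by (auto simp: B_def)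
  have e': "e / (2 * B) > 0" using \<open>e > 0\<close> B by simp
  obtain d1 where d1: "d1 > 0" "\<forall>(m::nat) u v. (\<forall>k<m. a \<le> u k \<and> u k \<le> v k \<and> v k \<le> b) \<longrightarrow>
        disjoint_family_on (\<lambda>k. {u k<..<v k}) {..<m} \<longrightarrow>
        (\<Sum>k<m. v k - u k) < d1 \<longrightarrow> (\<Sum>k<m. \<bar>f (v k) - f (u k)\<bar>) < e / (2 * B)"
    using abs_continuous_on_intervalD[OF f e'] by blast
  obtain d2 where d2: "d2 > 0" "\<forall>(m::nat) u v. (\<forall>k<m. a \<le> u k \<and> u k \<le> v k \<and> v k \<le> b) \<longrightarrow>
        disjoint_family_on (\<lambda>k. {u k<..<v k}) {..<m} \<longrightarrow>
        (\<Sum>k<m. v k - u k) < d2 \<longrightarrow> (\<Sum>k<m. \<bar>g (v k) - g (u k)\<bar>) < e / (2 * B)"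
    using abs_continuous_on_intervalD[OF g e'] by blast
  show "\<exists>\<delta>>0. \<forall>(m::nat) u v. (\<forall>k<m. a \<le> u k \<and> u k \<le> v k \<and> v k \<le> b) \<and>
      disjoint_family_on (\<lambda>k. {u k<..<v k}) {..<m} \<and> (\<Sum>k<m. v k - u k) < \<delta> \<longrightarrow>
      (\<Sum>k<m. \<bar>F (v k) - F (u k)\<bar>) < e"
  proof (intro exI[of _ "min d1 d2"] conjI allI impI)
    show "0 < min d1 d2" using d1 d2 by simp
    fix m :: nat and u v
    assume *: "(\<forall>k<m. a \<le> u k \<and> u k \<le> v k \<and> v k \<le> b) \<and>
      disjoint_family_on (\<lambda>k. {u k<..<v k}) {..<m} \<and> (\<Sum>k<m. v k - u k) < min d1 d2"
    have s1: "(\<Sum>k<m. \<bar>f (v k) - f (u k)\<bar>) < e / (2 * B)"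
      using d1(2)[rule_format, of m u v] * by simp
    have s2: "(\<Sum>k<m. \<bar>g (v k) - g (u k)\<bar>) < e / (2 * B)"
      using d2(2)[rule_format, of m u v] * by simp
    have "(\<Sum>k<m. \<bar>F (v k) - F (u k)\<bar>) \<le> (\<Sum>k<m. B * (\<bar>f (v k) - f (u k)\<bar> + \<bar>g (v k) - g (u k)\<bar>))"
    proof (rule sum_mono)
      fix k assume "k \<in> {..<m}"
      then have "a \<le> u k \<and> u k \<le> v k \<and> v k \<le> b" using * by blast
      then have "\<bar>F (v k) - F (u k)\<bar> \<le> C * (\<bar>f (v k) - f (u k)\<bar> + \<bar>g (v k) - g (u k)\<bar>)"
        by (intro dom) auto
      also have "\<dots> \<le> B * (\<bar>f (v k) - f (u k)\<bar> + \<bar>g (v k) - g (u k)\<bar>)"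
        using B by (intro mult_right_mono) auto
      finally show "\<bar>F (v k) - F (u k)\<bar> \<le> B * (\<bar>f (v k) - f (u k)\<bar> + \<bar>g (v k) - g (u k)\<bar>)" .
    qed
    also have "\<dots> = B * ((\<Sum>k<m. \<bar>f (v k) - f (u k)\<bar>) + (\<Sum>k<m. \<bar>g (v k) - g (u k)\<bar>))"
      by (simp only: sum_distrib_left sum.distrib distrib_left)
    also have "\<dots> < B * (e / (2 * B) + e / (2 * B))"
      using s1 s2 B by (intro mult_strict_left_mono) auto
    also have "\<dots> = e" using B by simp
    finally show "(\<Sum>k<m. \<bar>F (v k) - F (u k)\<bar>) < e" .
  qed
qed

lemma abs_continuous_const: "abs_continuous_on_interval a b (\<lambda>_. c)"
  unfolding abs_continuous_on_interval_def by (auto intro: exI[of _ 1])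

lemma abs_continuous_sum:
  assumes "finite J" "\<And>j. j \<in> J \<Longrightarrow> abs_continuous_on_interval a b (f j)"
  shows "abs_continuous_on_interval a b (\<lambda>t. \<Sum>j\<in>J. f j t)"
  using assms
proof (induction J)
  case empty
  show ?case by (simp add: abs_continuous_const)
next
  case (insert j J)
  then have "abs_continuous_on_interval a b (f j)" "abs_continuous_on_interval a b (\<lambda>t. \<Sum>j\<in>J. f j t)"
    by auto
  then show ?case
    by (rule abs_continuous_dominated[of _ _ _ _ _ 1]) (use insert in auto)
qed

lemma continuous_on_cot_half_diff:
  fixes S :: "real set"
  assumes "continuous_on S x" "continuous_on S y" "\<And>t. t \<in> S \<Longrightarrow> sin ((x t - y t) / 2) \<noteq> 0"
  shows "continuous_on S (\<lambda>t. cot ((x t - y t) / 2 :: real))"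
  unfolding cot_def using assms by (intro continuous_on_divide continuous_on_cos continuous_on_sin continuous_on_diff continuous_on_const) auto

text \<open>On a compact time interval the gaps stay away from 0 and 2 \<pi>, so the slopes cot (D t
  / 2) are bounded. The tangent inequality at each of two times bounds the difference of the values
  from both sides, hence each pair term is Lipschitz in its gap along the path.\<close>

lemma abs_continuous_partition_U:
  assumes ch: "\<And>t. 0 \<le> t \<Longrightarrow> \<theta> t \<in> torus_chamber n"
    and cont: "\<And>j. j \<in> {1..n} \<Longrightarrow> continuous_on {0..} (\<lambda>t. \<theta> t j)"
    and ac: "\<And>j. j \<in> {1..n} \<Longrightarrow> abs_continuous_on_interval 0 T (\<lambda>t. \<theta> t j)"
  shows "abs_continuous_on_interval 0 T (\<lambda>t. partition_U n (\<theta> t))"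
  unfolding partition_U_def sum_distrib_left
proof (intro abs_continuous_sum finite_atLeastAtMost finite_atLeastLessThan)
  fix j i assume ij: "j \<in> {1..n}" "i \<in> {1..<j}"
  then have i: "i \<in> {1..n}" by auto
  define D where "D = (\<lambda>t. \<theta> t j - \<theta> t i)"
  have D: "0 < D t" "D t < 2 * pi" if "0 \<le> t" for t
    using torus_chamber_diff[OF ch[OF that], of i j] ij by (auto simp: D_def)
  have "continuous_on {0..T} (\<lambda>t. cot (D t / 2))"
    unfolding D_def
  proof (rule continuous_on_cot_half_diff)
    show "continuous_on {0..T} (\<lambda>t. \<theta> t j)" "continuous_on {0..T} (\<lambda>t. \<theta> t i)"
      using cont[OF ij(1)] cont[OF i] by (auto elim: continuous_on_subset)
    fix t assume "t \<in> {0..T}"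
    then show "sin ((\<theta> t j - \<theta> t i) / 2) \<noteq> 0"
      using sin_gt_zero[of "D t / 2"] D[of t] by (auto simp: D_def)
  qed
  then have "bounded ((\<lambda>t. cot (D t / 2)) ` {0..T})"
    by (intro compact_imp_bounded compact_continuous_image) auto
  then have "\<exists>C. \<forall>t\<in>{0..T}. \<bar>cot (D t / 2)\<bar> \<le> C"
    unfolding bounded_iff by simp
  then obtain C where C: "\<And>t. t \<in> {0..T} \<Longrightarrow> \<bar>cot (D t / 2)\<bar> \<le> C"
    by blast
  have one: "- 2 * ln (sin (D x / 2)) - - 2 * ln (sin (D y / 2)) \<le> C * \<bar>D y - D x\<bar>"
    if "x \<in> {0..T}" "y \<in> {0..T}" for x y
  proof -
    have "- 2 * ln (sin (D x / 2)) - - 2 * ln (sin (D y / 2)) \<le> cot (D x / 2) * (D y - D x)"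
      using ln_sin_half_tangent[of "D x" "D y"] D that by simp
    also have "\<dots> \<le> \<bar>cot (D x / 2)\<bar> * \<bar>D y - D x\<bar>"
      by (metis abs_ge_self abs_mult)
    also have "\<dots> \<le> C * \<bar>D y - D x\<bar>"
      using C[OF that(1)] by (rule mult_right_mono) simp
    finally show ?thesis .
  qed
  show "abs_continuous_on_interval 0 T (\<lambda>t. - 2 * ln (sin ((\<theta> t j - \<theta> t i) / 2)))"
  proof (rule abs_continuous_dominated[OF ac[OF ij(1)] ac[OF i], of _ C])
    fix x y assume xy: "x \<in> {0..T}" "y \<in> {0..T}"
    have "0 \<le> C" using C[OF xy(1)] by linarith
    have "\<bar>- 2 * ln (sin (D y / 2)) - - 2 * ln (sin (D x / 2))\<bar> \<le> C * \<bar>D y - D x\<bar>"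
      using one[OF xy] one[OF xy(2,1)] by (simp add: abs_minus_commute abs_le_iff)
    also have "\<dots> \<le> C * (\<bar>\<theta> y j - \<theta> x j\<bar> + \<bar>\<theta> y i - \<theta> x i\<bar>)"
      using \<open>0 \<le> C\<close> by (intro mult_left_mono) (auto simp: D_def)
    finally show "\<bar>- 2 * ln (sin ((\<theta> y j - \<theta> y i) / 2)) - - 2 * ln (sin ((\<theta> x j - \<theta> x i) / 2))\<bar>
      \<le> C * (\<bar>\<theta> y j - \<theta> x j\<bar> + \<bar>\<theta> y i - \<theta> x i\<bar>)"
      by (simp add: D_def)
  qed
qed

lemma DERIV_partition_U:
  assumes "\<theta> s \<in> torus_chamber n"
    and "\<And>j. j \<in> {1..n} \<Longrightarrow> ((\<lambda>t. \<theta> t j) has_real_derivative v j) (at s)"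
  shows "((\<lambda>t. partition_U n (\<theta> t)) has_real_derivative (\<Sum>j=1..n. partition_grad n (\<theta> s) j * v j)) (at s)"
  unfolding partition_U_def sum_distrib_left partition_grad_inner
proof (intro DERIV_sum)
  fix j i assume ij: "j \<in> {1..n}" "i \<in> {1..<j}"
  then have "((\<lambda>t. \<theta> t j - \<theta> t i) has_real_derivative v j - v i) (at s)"
    using assms(2) by (intro DERIV_diff) auto
  moreover have "((\<lambda>x. - 2 * ln (sin (x / 2))) has_real_derivative - cot ((\<theta> s j - \<theta> s i) / 2)) (at (\<theta> s j - \<theta> s i))"
    using torus_chamber_diff[OF assms(1), of i j] ij by (intro DERIV_ln_sin_half) auto
  ultimately show "((\<lambda>t. - 2 * ln (sin ((\<theta> t j - \<theta> t i) / 2))) has_real_derivative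
      - cot ((\<theta> s j - \<theta> s i) / 2) * (v j - v i)) (at s)"
    by (rule DERIV_chain2[rotated])
qed

text \<open>Here \<open>v\<close> is the velocity and v + 2 g the deviation from the gradient flow.
  Completing the square gives g v \<le> (v + 2 g)^2 / 4 - g^2 in each coordinate; the denominator
  combines the square of 2 \<pi> from the gap estimate with the factor n from the Cauchy-Schwarz
  inequality.\<close>

lemma partition_U_dissipation:
  assumes "n \<ge> 1" "\<alpha> \<in> torus_chamber n"
  shows "(\<Sum>j=1..n. partition_grad n \<alpha> j * v j) \<le>
    (\<Sum>j=1..n. (v j + 2 * partition_grad n \<alpha> j)\<^sup>2) / 4
      - (partition_U n \<alpha> - partition_U n (equispaced n))\<^sup>2 / (4 * pi\<^sup>2 * n)"
proof -
  let ?g = "partition_grad n \<alpha>"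
  have "(partition_U n \<alpha> - partition_U n (equispaced n))\<^sup>2 \<le> (2 * pi * (\<Sum>j=1..n. \<bar>?g j\<bar>))\<^sup>2"
    using partition_U_gap_le_grad[OF assms] partition_U_equispaced_le[OF assms] by (intro power_mono) auto
  also have "\<dots> = 4 * pi\<^sup>2 * (\<Sum>j=1..n. \<bar>?g j\<bar>)\<^sup>2"
    by (simp add: power_mult_distrib)
  also have "\<dots> \<le> 4 * pi\<^sup>2 * ((\<Sum>j=1..n. \<bar>?g j\<bar>\<^sup>2) * real (card {1..n}))"
    by (intro mult_left_mono sum_squared_le_sum_of_squares) auto
  also have "\<dots> = (4 * pi\<^sup>2 * n) * (\<Sum>j=1..n. (?g j)\<^sup>2)"
    by simp
  finally have "(partition_U n \<alpha> - partition_U n (equispaced n))\<^sup>2 / (4 * pi\<^sup>2 * n) \<le> (\<Sum>j=1..n. (?g j)\<^sup>2)"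
    using assms(1) by (simp add: divide_le_eq mult.commute)
  moreover have "(\<Sum>j=1..n. ?g j * v j) \<le> (\<Sum>j=1..n. (v j + 2 * ?g j)\<^sup>2 / 4 - (?g j)\<^sup>2)"
  proof (rule sum_mono)
    fix j
    have "(v j + 2 * ?g j)\<^sup>2 / 4 - (?g j)\<^sup>2 - ?g j * v j = (v j)\<^sup>2 / 4"
      by (simp add: power2_eq_square field_simps)
    then show "?g j * v j \<le> (v j + 2 * ?g j)\<^sup>2 / 4 - (?g j)\<^sup>2"
      using zero_le_power2[of "v j"] by linarith
  qed
  ultimately show ?thesis
    by (simp add: sum_subtractf sum_divide_distrib)
qed

section \<open>Convergence from the integrated inequality\<close>

text \<open>\<open>K\<close> is the accumulated error. Being monotone and bounded, it grows by less
  than e / 2 after some time s. After s, \<open>F\<close> cannot remain above m + e / 2 for ever,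
  since it would fall below its lower bound; once below that level it can rise again by less than e
  / 2.\<close>

lemma dissipative_tendsto:
  fixes F K :: "real \<Rightarrow> real"
  assumes "\<And>t. 0 \<le> t \<Longrightarrow> m \<le> F t" "0 < c"
    and K: "\<And>a b. 0 \<le> a \<Longrightarrow> a \<le> b \<Longrightarrow> K a \<le> K b" "\<And>t. 0 \<le> t \<Longrightarrow> K t \<le> B"
    and inc: "\<And>a b. 0 \<le> a \<Longrightarrow> a \<le> b \<Longrightarrow> F b - F a \<le> K b - K a"
    and dec: "\<And>a b e. 0 \<le> a \<Longrightarrow> a \<le> b \<Longrightarrow> 0 < e \<Longrightarrow> (\<forall>t\<in>{a..b}. m + e \<le> F t) \<Longrightarrow>
      F b - F a \<le> K b - K a - c * e\<^sup>2 * (b - a)"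
  shows "(F \<longlongrightarrow> m) at_top"
proof -
  have "\<exists>s. \<forall>t\<ge>s. F t < m + e" if e: "0 < e" for e
  proof -
    have bdd: "bdd_above (K ` {0..})" using K(2) by (auto intro!: bdd_aboveI)
    obtain s where s: "0 \<le> s" "Sup (K ` {0..}) - e / 2 < K s"
      using less_cSupD[of "K ` {0..}" "Sup (K ` {0..}) - e / 2"] e by auto
    have tail: "K b - K a < e / 2" if "s \<le> a" "a \<le> b" for a b
    proof -
      have "K b \<le> Sup (K ` {0..})" using bdd that s by (intro cSup_upper) auto
      moreover have "K s \<le> K a" using K(1) s that by auto
      ultimately show ?thesis using s(2) by linarith
    qed
    have "\<exists>r\<ge>s. F r < m + e / 2"
    proof (rule ccontr)
      assume "\<not> ?thesis"
      then have ge: "m + e / 2 \<le> F r" if "s \<le> r" for r using that by (auto simp: not_less)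
      define q where "q = c * (e / 2)\<^sup>2"
      have pos: "0 < q" using assms(2) e by (simp add: q_def)
      \<comment> \<open>The waiting time makes the guaranteed loss q * (b - s) equal to F s - m + e,
        more than the available height plus the error e / 2.\<close>
      define b where "b = s + (F s - m + e) / q"
      have "s \<le> b" using pos assms(1)[OF s(1)] e by (simp add: b_def)
      then have "F b - F s \<le> K b - K s - q * (b - s)"
        unfolding q_def using s(1) e ge by (intro dec) auto
      also have "q * (b - s) = F s - m + e"
        using pos by (simp add: b_def)
      finally have "F b < m"
        using tail[of s b] \<open>s \<le> b\<close> e by simp
      then show False using assms(1)[of b] s \<open>s \<le> b\<close> by simp
    qed
    then obtain r where r: "s \<le> r" "F r < m + e / 2" by blast
    have "F t < m + e" if "r \<le> t" for t
      using inc[of r t] tail[of r t] r s that by simp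
    then show ?thesis by blast
  qed
  then have upper: "\<forall>\<^sub>F t in at_top. F t < a" if "m < a" for a
    using that by (metis add_diff_cancel_left' diff_gt_0_iff_gt eventually_at_top_linorder add.commute diff_add_cancel)
  show ?thesis
  proof (rule order_tendstoI)
    fix a assume "a < m"
    then show "\<forall>\<^sub>F t in at_top. a < F t"
      using assms(1) by (auto simp: eventually_at_top_linorder intro!: exI[of _ 0] elim: less_le_trans)
  qed (rule upper)
qed

text \<open>\<^const>\<open>deriv\<close> need not be measurable where the derivative fails to exist, so it is replaced by
  a limit of difference quotients.\<close>

lemma finite_energy_density:
  fixes \<theta> :: "real \<Rightarrow> nat \<Rightarrow> real"
  assumes cont: "\<And>j. j \<in> {1..n} \<Longrightarrow> continuous_on {0..} (\<lambda>t. \<theta> t j)"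
    and diff: "AE s in lborel. 0 < s \<longrightarrow> (\<forall>j\<in>{1..n}. (\<lambda>t. \<theta> t j) differentiable (at s))"
    and fin: "(\<integral>\<^sup>+ s\<in>{0..}. ennreal (\<Sum>j=1..n. \<bar>deriv (\<lambda>t. \<theta> t j) s
               - 2 * (\<Sum>i\<in>{1..n} - {j}. cot ((\<theta> s j - \<theta> s i) / 2))\<bar>\<^sup>2) \<partial>lborel) < \<infinity>"
  obtains k :: "real \<Rightarrow> real" where "integrable lborel k" "\<And>s. 0 \<le> k s"
    "AE s in lborel. 0 < s \<longrightarrow> k s = (\<Sum>j=1..n. (deriv (\<lambda>t. \<theta> t j) s + 2 * partition_grad n (\<theta> s) j)\<^sup>2)"
proof -
  \<comment> \<open>Freezing the path at negative times gives functions continuous on the whole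
    line.\<close>
  define \<Theta> where "\<Theta> = (\<lambda>j s. \<theta> (max 0 s) j)"
  \<comment> \<open>\<open>lim\<close> of a sequence of measurable functions is measurable even
    where the sequence diverges, and it equals \<open>deriv\<close> wherever the derivative
    exists.\<close>
  define d where "d = (\<lambda>j s. lim (\<lambda>m. (\<Theta> j (s + inverse (real (Suc m))) - \<Theta> j s) / inverse (real (Suc m))))"
  define k where "k = (\<lambda>s::real. indicat_real {0..} s * (\<Sum>j=1..n. (d j s + 2 * partition_grad n (\<lambda>i. \<Theta> i s) j)\<^sup>2))"
  have c\<Theta>: "continuous_on UNIV (\<Theta> j)" if "j \<in> {1..n}" for j
    unfolding \<Theta>_def by (rule continuous_on_compose2[OF cont[OF that]]) (auto intro!: continuous_intros)
  have m\<Theta>: "\<Theta> j \<in> borel_measurable lborel" if "j \<in> {1..n}" for j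
    using borel_measurable_continuous_onI[OF c\<Theta>[OF that]] by simp
  have md: "d j \<in> borel_measurable lborel" if j: "j \<in> {1..n}" for j
  proof -
    have "(\<lambda>s. \<Theta> j (s + inverse (real (Suc m)))) \<in> borel_measurable lborel" for m
      using m\<Theta>[OF j] by measurable
    then show ?thesis
      unfolding d_def using m\<Theta>[OF j] by (intro borel_measurable_lim_metric borel_measurable_divide borel_measurable_diff) auto
  qed
  have mg: "(\<lambda>s. partition_grad n (\<lambda>i. \<Theta> i s) j) \<in> borel_measurable lborel" if j: "j \<in> {1..n}" for j
    unfolding partition_grad_def cot_def using m\<Theta> j
    by (intro borel_measurable_uminus borel_measurable_sum borel_measurable_divide
        measurable_compose[OF _ borel_measurable_sin] measurable_compose[OF _ borel_measurable_cos]
        borel_measurable_diff) auto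
  have mk: "k \<in> borel_measurable lborel"
    unfolding k_def using md mg
    by (intro borel_measurable_times borel_measurable_sum borel_measurable_power borel_measurable_add) auto
  have k0: "0 \<le> k s" for s
    unfolding k_def by (intro mult_nonneg_nonneg sum_nonneg) auto
  have d_eq: "d j s = deriv (\<lambda>t. \<theta> t j) s" if "0 < s" "(\<lambda>t. \<theta> t j) differentiable (at s)" for j s
  proof -
    have "((\<lambda>t. \<theta> t j) has_real_derivative deriv (\<lambda>t. \<theta> t j) s) (at s)"
      using that(2) DERIV_deriv_iff_real_differentiable by blast
    then have "((\<lambda>h. (\<theta> (s + h) j - \<theta> s j) / h) \<longlongrightarrow> deriv (\<lambda>t. \<theta> t j) s) (at 0)"
      by (simp add: DERIV_def)
    moreover have "filterlim (\<lambda>m. inverse (real (Suc m))) (at 0) sequentially"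
      using LIMSEQ_inverse_real_of_nat by (intro filterlim_atI) auto
    ultimately have "(\<lambda>m. (\<theta> (s + inverse (real (Suc m))) j - \<theta> s j) / inverse (real (Suc m))) \<longlonglongrightarrow> deriv (\<lambda>t. \<theta> t j) s"
      by (rule filterlim_compose)
    moreover have "max 0 (s + inverse (real (Suc m))) = s + inverse (real (Suc m))" for m
      using that(1) by (simp add: add_nonneg_nonneg max_absorb2)
    ultimately show ?thesis
      unfolding d_def \<Theta>_def using that(1) by (intro limI) simp
  qed
  have AE: "AE s in lborel. 0 < s \<longrightarrow> k s = (\<Sum>j=1..n. (deriv (\<lambda>t. \<theta> t j) s + 2 * partition_grad n (\<theta> s) j)\<^sup>2)"
    using diff
  proof eventually_elim
    case (elim s)
    show ?case
    proof
      assume s: "0 < s"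
      then have "\<Theta> i s = \<theta> s i" for i by (simp add: \<Theta>_def)
      then show "k s = (\<Sum>j=1..n. (deriv (\<lambda>t. \<theta> t j) s + 2 * partition_grad n (\<theta> s) j)\<^sup>2)"
        using elim s d_eq unfolding k_def by simp
    qed
  qed
  \<comment> \<open>The identity for \<open>k\<close> holds at almost every positive time; the
    remaining nonnegative point 0 is null.\<close>
  have "AE s in lborel. ennreal (k s) = ennreal (\<Sum>j=1..n. \<bar>deriv (\<lambda>t. \<theta> t j) s
               - 2 * (\<Sum>i\<in>{1..n} - {j}. cot ((\<theta> s j - \<theta> s i) / 2))\<bar>\<^sup>2) * indicator {0..} s"
    using AE AE_lborel_singleton[of 0]
  proof eventually_elim
    case (elim s)
    then consider "s < 0" | "0 < s" "k s = (\<Sum>j=1..n. (deriv (\<lambda>t. \<theta> t j) s + 2 * partition_grad n (\<theta> s) j)\<^sup>2)"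
      by linarith
    then show ?case
    proof cases
      case 1
      then show ?thesis by (simp add: k_def)
    next
      case 2
      then show ?thesis by (simp add: partition_grad_def)
    qed
  qed
  then have "(\<integral>\<^sup>+ s. ennreal (k s) \<partial>lborel) < \<infinity>"
    using fin by (simp add: nn_integral_cong_AE)
  then have "integrable lborel k"
    using mk k0 by (intro integrableI_nonneg) auto
  then show thesis using that k0 AE by blast
qed

text \<open>Absolute continuity of the partition function along the path turns the almost-everywhere
  dissipation estimate into the two increment bounds that \<open>dissipative_tendsto\<close> asks
  for.\<close>

theorem finite_energy_partition_U_tendsto:
  fixes \<theta> :: "real \<Rightarrow> nat \<Rightarrow> real"
  assumes n: "n \<ge> 1"
    and ch: "\<And>t. 0 \<le> t \<Longrightarrow> \<theta> t \<in> torus_chamber n"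
    and cont: "\<And>j. j \<in> {1..n} \<Longrightarrow> continuous_on {0..} (\<lambda>t. \<theta> t j)"
    and fin: "driving_energy n \<theta> < \<infinity>"
  shows "((\<lambda>t. partition_U n (\<theta> t)) \<longlongrightarrow> partition_U n (equispaced n)) at_top"
proof -
  have ac: "abs_continuous_on_interval 0 T (\<lambda>t. \<theta> t j)" if "0 \<le> T" "j \<in> {1..n}" for T j
    using fin that unfolding driving_energy_def by (auto split: if_splits)
  then have acF: "abs_continuous_on_interval 0 T (\<lambda>t. partition_U n (\<theta> t))" if "0 \<le> T" for T
    using that by (intro abs_continuous_partition_U ch cont) auto
  have "(1 / 2) * (\<integral>\<^sup>+ s\<in>{0..}. ennreal (\<Sum>j=1..n. \<bar>deriv (\<lambda>t. \<theta> t j) s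
               - 2 * (\<Sum>i\<in>{1..n} - {j}. cot ((\<theta> s j - \<theta> s i) / 2))\<bar>\<^sup>2) \<partial>lborel) < \<infinity>"
    using fin ac unfolding driving_energy_def by (simp split: if_splits)
  then have fin': "(\<integral>\<^sup>+ s\<in>{0..}. ennreal (\<Sum>j=1..n. \<bar>deriv (\<lambda>t. \<theta> t j) s
               - 2 * (\<Sum>i\<in>{1..n} - {j}. cot ((\<theta> s j - \<theta> s i) / 2))\<bar>\<^sup>2) \<partial>lborel) < \<infinity>"
    by (auto simp: ennreal_mult_less_top)
  \<comment> \<open>Absolute continuity is available on bounded intervals; integer endpoints exhaust
    the half-line with countably many null sets.\<close>
  have "AE s in lborel. \<forall>j\<in>{1..n}. 0 < s \<and> s < real T \<longrightarrow> (\<lambda>t. \<theta> t j) differentiable (at s)" for T :: nat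
    by (intro AE_finite_allI finite_atLeastAtMost abs_continuous_AE_differentiable ac) auto
  then have "AE s in lborel. \<forall>T::nat. \<forall>j\<in>{1..n}. 0 < s \<and> s < real T \<longrightarrow> (\<lambda>t. \<theta> t j) differentiable (at s)"
    by (intro AE_all_countable[THEN iffD2] allI)
  then have diff: "AE s in lborel. 0 < s \<longrightarrow> (\<forall>j\<in>{1..n}. (\<lambda>t. \<theta> t j) differentiable (at s))"
    by eventually_elim (meson reals_Archimedean2)
  obtain k where k: "integrable lborel k" "\<And>s. 0 \<le> k s"
    "AE s in lborel. 0 < s \<longrightarrow> k s = (\<Sum>j=1..n. (deriv (\<lambda>t. \<theta> t j) s + 2 * partition_grad n (\<theta> s) j)\<^sup>2)"
    using finite_energy_density[OF cont diff fin'] by blast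
  define F where "F = (\<lambda>t. partition_U n (\<theta> t))"
  define m where "m = partition_U n (equispaced n)"
  define c where "c = 1 / (4 * pi\<^sup>2 * n)"
  have c: "0 < c" using n by (simp add: c_def)
  have F_ge: "m \<le> F t" if "0 \<le> t" for t
    using partition_U_equispaced_le[OF n ch[OF that]] by (simp add: m_def F_def)
  have AE: "AE s in lborel. 0 < s \<longrightarrow> (\<exists>D. (F has_real_derivative D) (at s) \<and> D \<le> k s / 4 - c * (F s - m)\<^sup>2)"
    using diff k(3)
  proof eventually_elim
    case (elim s)
    show ?case
    proof
      assume s: "0 < s"
      have "(F has_real_derivative (\<Sum>j=1..n. partition_grad n (\<theta> s) j * deriv (\<lambda>t. \<theta> t j) s)) (at s)"
        unfolding F_def using elim(1) s ch
        by (intro DERIV_partition_U) (auto simp: DERIV_deriv_iff_real_differentiable)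
      moreover have "(\<Sum>j=1..n. partition_grad n (\<theta> s) j * deriv (\<lambda>t. \<theta> t j) s) \<le> k s / 4 - c * (F s - m)\<^sup>2"
        using partition_U_dissipation[OF n ch[of s], of "\<lambda>j. deriv (\<lambda>t. \<theta> t j) s"] elim(2) s
        by (simp add: c_def F_def m_def)
      ultimately show "\<exists>D. (F has_real_derivative D) (at s) \<and> D \<le> k s / 4 - c * (F s - m)\<^sup>2" by blast
    qed
  qed
  have kU: "k integrable_on UNIV" using k(1) by (rule integrable_on_lborel)
  then have kI: "k integrable_on {a..b}" for a b
    using integrable_on_subcbox[OF kU, of a b] by simp
  \<comment> \<open>The primitive of the error term k / 4 in the dissipation estimate; it is bounded
    because the energy is finite.\<close>
  define K where "K = (\<lambda>t. integral {0..t} k / 4)"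
  have hK: "((\<lambda>s. k s / 4) has_integral K b - K a) {a..b}" if "0 \<le> a" "a \<le> b" for a b
  proof -
    have "integral {0..a} k + integral {a..b} k = integral {0..b} k"
      using that kI by (intro Henstock_Kurzweil_Integration.integral_combine) auto
    then have eq: "K b - K a = integral {a..b} k / 4" by (simp add: K_def field_simps)
    show ?thesis unfolding eq by (intro has_integral_divide integrable_integral kI)
  qed
  have "(F \<longlongrightarrow> m) at_top"
  proof (rule dissipative_tendsto[where K=K and B="integral UNIV k / 4", OF F_ge c])
    fix a b :: real assume ab: "0 \<le> a" "a \<le> b"
    have "0 \<le> K b - K a"
      by (rule has_integral_nonneg[OF hK[OF ab]]) (simp add: k(2))
    then show "K a \<le> K b" by simp
    show "F b - F a \<le> K b - K a"
    proof (rule abs_continuous_increment_le_integral[OF acF[folded F_def] ab order_refl hK[OF ab]])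
      show "AE x in lborel. x \<in> {a<..<b} \<longrightarrow> (\<exists>D. (F has_real_derivative D) (at x) \<and> D \<le> k x / 4)"
        using AE
      proof eventually_elim
        case (elim x)
        have "0 \<le> c * (F x - m)\<^sup>2" using c by simp
        with elim ab show ?case by force
      qed
    qed (use ab in auto)
  next
    fix t :: real assume "0 \<le> t"
    show "K t \<le> integral UNIV k / 4"
      unfolding K_def using kI kU k(2) by (intro divide_right_mono integral_subset_le) auto
  next
    fix a b e :: real assume ab: "0 \<le> a" "a \<le> b" "0 < e" and ge: "\<forall>t\<in>{a..b}. m + e \<le> F t"
    \<comment> \<open>As long as F \<ge> m + e, the dissipation c * (F - m)^2 is at least c * e^2,
      so the upper bound for the derivative may be lowered by this constant.\<close>
    have "((\<lambda>s. k s / 4 - c * e\<^sup>2) has_integral (K b - K a) - (b - a) * (c * e\<^sup>2)) {a..b}"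
      using has_integral_diff[OF hK[OF ab(1,2)] has_integral_const_real[of "c * e\<^sup>2" a b]] ab by simp
    then have hK': "((\<lambda>s. k s / 4 - c * e\<^sup>2) has_integral K b - K a - c * e\<^sup>2 * (b - a)) {a..b}"
      by (simp add: mult.commute)
    show "F b - F a \<le> K b - K a - c * e\<^sup>2 * (b - a)"
    proof (rule abs_continuous_increment_le_integral[OF acF[folded F_def] ab(1,2) order_refl hK'])
      show "AE x in lborel. x \<in> {a<..<b} \<longrightarrow> (\<exists>D. (F has_real_derivative D) (at x) \<and> D \<le> k x / 4 - c * e\<^sup>2)"
        using AE
      proof eventually_elim
        case (elim x)
        show ?case
        proof
          assume x: "x \<in> {a<..<b}"
          then have "m + e \<le> F x" using ge by (meson greaterThanLessThan_subseteq_atLeastAtMost_iff order_refl subsetD)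
          then have "e \<le> F x - m" by simp
          then have "c * e\<^sup>2 \<le> c * (F x - m)\<^sup>2"
            using c ab(3) by (intro mult_left_mono power_mono) auto
          with elim x ab(1) show "\<exists>D. (F has_real_derivative D) (at x) \<and> D \<le> k x / 4 - c * e\<^sup>2" by force
        qed
      qed
    qed (use ab in auto)
  qed
  then show ?thesis by (simp add: F_def[abs_def] m_def)
qed

theorem proposition1p4:
  fixes n :: nat
    and \<theta>0 :: "nat \<Rightarrow> real"
    and \<gamma> :: "nat \<Rightarrow> real \<Rightarrow> complex"
    and \<theta> :: "real \<Rightarrow> nat \<Rightarrow> real"
  assumes "n \<ge> 1"
    and "\<theta>0 \<in> torus_chamber n"
    and "\<gamma> \<in> radial_multichords n \<theta>0"
    and "multiradial_driving n \<gamma> \<theta>"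
    and "multiradial_energy n \<gamma> < \<infinity>"
  shows "((\<lambda>T. ereal (partition_U n (\<theta> T))) \<longlongrightarrow>
            (INF \<alpha>\<in>torus_chamber n. ereal (partition_U n \<alpha>))) at_top
    \<and> (INF \<alpha>\<in>torus_chamber n. ereal (partition_U n \<alpha>))
        = ereal (- 2 * (\<Sum>j=1..n. \<Sum>i=1..<j. ln (sin (pi * (real j - real i) / real n))))"
proof -
  \<comment> \<open>Finiteness of the energy is known for this choice only, so the limit is proved
    along \<phi> and then transferred to \<theta>.\<close>
  define \<phi> where "\<phi> = (SOME \<theta>. multiradial_driving n \<gamma> \<theta>)"
  have \<phi>: "multiradial_driving n \<gamma> \<phi>"
    unfolding \<phi>_def using someI[of "multiradial_driving n \<gamma>", OF assms(4)] .
  have "((\<lambda>t. partition_U n (\<phi> t)) \<longlongrightarrow> partition_U n (equispaced n)) at_top"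
    using \<phi> assms(1,5) unfolding multiradial_driving_def multiradial_energy_def \<phi>_def[symmetric]
    by (intro finite_energy_partition_U_tendsto) auto
  \<comment> \<open>The driving points were identified at positive times, which suffices for a limit
    at infinity.\<close>
  moreover have "\<forall>\<^sub>F t in at_top. partition_U n (\<phi> t) = partition_U n (\<theta> t)"
    using eventually_gt_at_top[of 0]
  proof eventually_elim
    case (elim t)
    then show ?case
      using assms(3) by (intro multiradial_driving_partition_U_unique[OF _ \<phi> assms(4)]) (auto simp: radial_multichords_def)
  qed
  ultimately have "((\<lambda>t. partition_U n (\<theta> t)) \<longlongrightarrow> partition_U n (equispaced n)) at_top"
    by (simp add: tendsto_cong)
  then show ?thesis
    using INF_partition_U[OF assms(1)] partition_U_equispaced[of n] by simp
qed

end
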